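(* For any integers $r\geq1$ and $n\geq3$, an $\mathrm{EITFF}_{\mathbb{C}}(2r,r,n)$ with total symmetry exists if and only if $n\leq\rho_{\mathbb{C}}(r)+1$, where $\rho_{\mathbb{C}}(r)=8b+2c+2$ when $r=(2a+1)2^{4b+c}$ with nonnegative integers $a,b,c$ and $c\leq3$.
   Context: EITFFs. Let $(\mathcal{U}_i)_{i=1}^n$, $n\geq2$, be $r$-dimensional subspaces of a $d$-dimensional complex Hilbert space $\mathcal{E}$, with orthogonal projections $\Pi_i$. The sequence is an $\mathrm{EITFF}_{\mathbb{C}}(d,r,n)$ (equi-isoclinic tight fusion frame) if it is equi-isoclinic, meaning there is $\sigma\geq0$ with $\Pi_i\Pi_j\Pi_i=\sigma^2\Pi_i$ for all $i\neq j$, and is a tight fusion frame for $\mathcal{E}$, meaning $\sum_{i=1}^n\Pi_i=aI$ for some $a>0$. Symmetry. A permutation $\sigma$ of $\{1,\dots,n\}$ is a symmetry of $(\mathcal{U}_i)_{i=1}^n$ if there is a unitary $\Upsilon_\sigma:\mathcal{E}\to\mathcal{E}$ such that $\Pi_{\sigma(i)}=\Upsilon_\sigma\Pi_i\Upsilon_\sigma^*$ for all $i$ (equivalently $\mathcal{U}_{\sigma(i)}=\Upsilon_\sigma(\mathcal{U}_i)$ for all $i$). The sequence has total symmetry if every permutation in the symmetric group $S_n$ is a symmetry of it. The number $\rho_{\mathbb{C}}(r)$ is the classical complex Radon–Hurwitz number: the maximum dimension of a real subspace of $\mathbb{C}^{r\times r}$ whose every member is a scalar multiple of a unitary; equivalently,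 the maximum $m$ for which there are unitaries $C_1,\dots,C_m\in\mathbb{C}^{r\times r}$ with $C_i^*C_j+C_j^*C_i=0$ for all $i\neq j$. Its value is given by the formula in the claim. *)

theory Defs
  imports "HOL-Analysis.Analysis"
begin

text \<open>A \<open>d\<close>-dimensional complex Hilbert space is modelled as \<^typ>\<open>complex^'d\<close> with \<open>CARD('d) = d\<close>
  and the standard Hermitian inner product, since \<^const>\<open>inner\<close> on this type is only the real part
  of it.  Complex subspaces and complex dimension are \<open>vec.subspace\<close> and \<open>vec.dim\<close>; the unqualified
  \<^const>\<open>subspace\<close> and \<^const>\<open>dim\<close> are the real notions.\<close>

definition cinner :: "complex^'d \<Rightarrow> complex^'d \<Rightarrow> complex"
  where "cinner x y = (\<Sum>i\<in>UNIV. x $ i * cnj (y $ i))"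

definition cadjoint :: "complex^'m^'n \<Rightarrow> complex^'n^'m"
  where "cadjoint A = (\<chi> i j. cnj (A $ j $ i))"

definition unitary_matrix :: "complex^'n^'n \<Rightarrow> bool"
  where "unitary_matrix U \<longleftrightarrow> cadjoint U ** U = mat 1 \<and> U ** cadjoint U = mat 1"

definition orth_proj :: "(complex^'d) set \<Rightarrow> complex^'d^'d"
  where "orth_proj S = (THE P. \<forall>x. P *v x \<in> S \<and> (\<forall>u\<in>S. cinner (x - P *v x) u = 0))"

definition equi_isoclinic :: "nat \<Rightarrow> (nat \<Rightarrow> (complex^'d) set) \<Rightarrow> bool"
  where "equi_isoclinic n U \<longleftrightarrow>
    (\<exists>\<sigma>::real. \<sigma> \<ge> 0 \<and> (\<forall>i\<in>{1..n}. \<forall>j\<in>{1..n}. i \<noteq> j \<longrightarrow>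
       orth_proj (U i) ** orth_proj (U j) ** orth_proj (U i) = \<sigma>\<^sup>2 *\<^sub>R orth_proj (U i)))"

definition tight_fusion_frame :: "nat \<Rightarrow> (nat \<Rightarrow> (complex^'d) set) \<Rightarrow> bool"
  where "tight_fusion_frame n U \<longleftrightarrow>
    (\<exists>a::real. a > 0 \<and> (\<Sum>i=1..n. orth_proj (U i)) = a *\<^sub>R mat 1)"

text \<open>\<open>EITFF r n U\<close>: the subspaces \<open>U 1, \<dots>, U n\<close> form an EITFF with parameters \<open>(CARD('d), r, n)\<close>
  over the complex numbers; values of \<open>U\<close> outside \<open>{1..n}\<close> are irrelevant.\<close>

definition EITFF :: "nat \<Rightarrow> nat \<Rightarrow> (nat \<Rightarrow> (complex^'d) set) \<Rightarrow> bool"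
  where "EITFF r n U \<longleftrightarrow>
    n \<ge> 2 \<and> (\<forall>i\<in>{1..n}. vec.subspace (U i) \<and> vec.dim (U i) = r) \<and>
    equi_isoclinic n U \<and> tight_fusion_frame n U"

definition is_symmetry :: "nat \<Rightarrow> (nat \<Rightarrow> (complex^'d) set) \<Rightarrow> (nat \<Rightarrow> nat) \<Rightarrow> bool"
  where "is_symmetry n U p \<longleftrightarrow>
    (\<exists>Y. unitary_matrix Y \<and>
       (\<forall>i\<in>{1..n}. orth_proj (U (p i)) = Y ** orth_proj (U i) ** cadjoint Y))"

definition total_symmetry :: "nat \<Rightarrow> (nat \<Rightarrow> (complex^'d) set) \<Rightarrow> bool"
  where "total_symmetry n U \<longleftrightarrow> (\<forall>p. p permutes {1..n} \<longrightarrow> is_symmetry n U p)"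

definition scaled_unitary :: "complex^'n^'n \<Rightarrow> bool"
  where "scaled_unitary A \<longleftrightarrow> (\<exists>c U. unitary_matrix U \<and> A = (\<chi> i j. c * U $ i $ j))"

definition radon_hurwitz_complex :: "'r::finite itself \<Rightarrow> nat"
  where "radon_hurwitz_complex _ =
    Max {dim V | V :: (complex^'r^'r) set. subspace V \<and> (\<forall>A\<in>V. scaled_unitary A)}"

text \<open>The descriptions in \<^const>\<open>orth_proj\<close> and \<^const>\<open>radon_hurwitz_complex\<close> are proper.\<close>

lemma cinner_diff_left: "cinner (x - y) z = cinner x z - cinner y z"
  by (simp add: cinner_def left_diff_distrib sum_subtractf)

lemma cinner_scale_right: "cinner x (c *s y) = cnj c * cinner x y"
  by (simp add: cinner_def sum_distrib_left algebra_simps)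

lemma Re_cinner: "Re (cinner x y) = inner x y"
  by (simp add: cinner_def inner_vec_def inner_complex_def)

lemma cinner_self_eq_0: "cinner x x = 0 \<Longrightarrow> x = 0"
  using Re_cinner[of x x] by simp

lemma csubspace_imp_subspace:
  assumes "vec.subspace (S :: (complex^'d) set)"
  shows "subspace S"
proof -
  have "c *\<^sub>R x = complex_of_real c *s x" for c and x :: "complex^'d"
    by (simp add: vec_eq_iff complex_eq_iff)
  then show ?thesis
    using assms unfolding subspace_def vec.subspace_def by auto
qed

lemma orth_decomp_unique:
  assumes S: "vec.subspace S"
    and "y \<in> S" "\<forall>u\<in>S. cinner (x - y) u = 0" "z \<in> S" "\<forall>u\<in>S. cinner (x - z) u = 0"
  shows "y = z"
proof -
  have m: "y - z \<in> S" using S assms vec.subspace_diff by blast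
  have "cinner (y - z) (y - z) = cinner (x - z) (y - z) - cinner (x - y) (y - z)"
    by (simp add: cinner_diff_left)
  also have "\<dots> = 0" using m assms by simp
  finally show ?thesis using cinner_self_eq_0 by fastforce
qed

lemma orth_decomp_exists:
  assumes S: "vec.subspace S"
  shows "\<exists>y\<in>S. \<forall>u\<in>S. cinner (x - y) u = 0"
proof -
  have sp: "span S = S" using S csubspace_imp_subspace span_eq_iff by blast
  obtain y z where y: "y \<in> span S" and z: "\<And>w. w \<in> span S \<Longrightarrow> orthogonal z w" and x: "x = y + z"
    using orthogonal_subspace_decomp_exists[of S x] by metis
  have "cinner z u = 0" if u: "u \<in> S" for u
  proof -
    have iu: "\<i> *s u \<in> S" using S u vec.subspace_scale by blast
    have "Re (cinner z u) = 0" "Re (cinner z (\<i> *s u)) = 0"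
      using z[unfolded sp] u iu by (simp_all add: Re_cinner orthogonal_def)
    then show ?thesis by (simp add: cinner_scale_right complex_eq_iff)
  qed
  then show ?thesis using y x sp by (intro bexI[of _ y]) simp_all
qed

lemma orth_proj_ex1:
  assumes S: "vec.subspace (S :: (complex^'d) set)"
  shows "\<exists>!P. \<forall>x. P *v x \<in> S \<and> (\<forall>u\<in>S. cinner (x - P *v x) u = 0)"
proof -
  obtain f where f: "\<And>x. f x \<in> S" "\<And>x u. u \<in> S \<Longrightarrow> cinner (x - f x) u = 0"
    using orth_decomp_exists[OF S] by metis
  have f_eq: "f x = y" if "y \<in> S" "\<And>u. u \<in> S \<Longrightarrow> cinner (x - y) u = 0" for x y
    using orth_decomp_unique[OF S] f that by blast
  have add: "f (x + y) = f x + f y" for x y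
  proof (rule f_eq)
    show "f x + f y \<in> S" using S f vec.subspace_add by blast
    show "cinner (x + y - (f x + f y)) u = 0" if "u \<in> S" for u
    proof -
      have "cinner (x + y - (f x + f y)) u = cinner (x - f x) u + cinner (y - f y) u"
        by (simp add: cinner_def algebra_simps sum.distrib sum_subtractf)
      then show ?thesis using f that by simp
    qed
  qed
  have scale: "f (c *s x) = c *s f x" for c x
  proof (rule f_eq)
    show "c *s f x \<in> S" using S f vec.subspace_scale by blast
    show "cinner (c *s x - c *s f x) u = 0" if "u \<in> S" for u
    proof -
      have "cinner (c *s x - c *s f x) u = c * cinner (x - f x) u"
        by (simp add: cinner_def algebra_simps sum_distrib_left sum_subtractf)
      then show ?thesis using f that by simp
    qed
  qed
  have lin: "Vector_Spaces.linear (*s) (*s) f"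
    by unfold_locales (use add scale in simp_all)
  have mf: "matrix f *v x = f x" for x
    using matrix_works[OF lin] .
  show ?thesis
  proof (rule ex1I[of _ "matrix f"])
    show "\<forall>x. matrix f *v x \<in> S \<and> (\<forall>u\<in>S. cinner (x - matrix f *v x) u = 0)"
      using mf f by simp
    fix P :: "complex^'d^'d"
    assume "\<forall>x. P *v x \<in> S \<and> (\<forall>u\<in>S. cinner (x - P *v x) u = 0)"
    then have "P *v x = matrix f *v x" for x
      using f_eq[of "P *v x" x] mf by simp
    then show "P = matrix f" by (simp add: matrix_eq)
  qed
qed

lemma orth_proj_works:
  assumes "vec.subspace S"
  shows "orth_proj S *v x \<in> S" and "u \<in> S \<Longrightarrow> cinner (x - orth_proj S *v x) u = 0"
  using theI'[OF orth_proj_ex1[OF assms]] unfolding orth_proj_def by blast+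

lemma radon_hurwitz_complex_set:
  fixes D
  defines "D \<equiv> {dim V | V :: (complex^'r^'r) set. subspace V \<and> (\<forall>A\<in>V. scaled_unitary A)}"
  shows "finite D" and "D \<noteq> {}"
proof -
  have "D \<subseteq> {..DIM(complex^'r^'r)}"
    unfolding D_def using dim_subset_UNIV by blast
  then show "finite D" by (rule finite_subset) simp
  have "unitary_matrix (mat 1 :: complex^'r^'r)"
  proof -
    have "cadjoint (mat 1 :: complex^'r^'r) = mat 1"
      by (simp add: cadjoint_def mat_def vec_eq_iff)
    then show ?thesis by (simp add: unitary_matrix_def)
  qed
  then have "scaled_unitary (0 :: complex^'r^'r)"
    unfolding scaled_unitary_def by (intro exI[of _ 0] exI[of _ "mat 1"]) (simp add: vec_eq_iff)
  then have "dim {0 :: complex^'r^'r} \<in> D"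
    unfolding D_def by (intro CollectI exI[of _ "{0}"]) auto
  then show "D \<noteq> {}" by blast
qed

end

theory Submission
  imports Defs
begin

text \<open>Let \<open>R i = 2 *\<^sub>R P i - mat 1\<close> be the reflections of an EITFF of \<open>n\<close> subspaces of half dimension.
  The equi-isoclinic condition makes all anticommutators of the \<open>R i\<close> scalar, so the \<open>R i\<close> are the
  vertices of a simplex in the span of \<open>n - 1\<close> anticommuting involutions, and a transposition of two
  vertices acts on this span as a reflection.  A system of \<open>m\<close> anticommuting involutions on a space
  of dimension \<open>2 * r\<close> one of which can be negated by a conjugation fixing the others forces
  \<open>2 ^ ((m + 1) div 2)\<close> to divide \<open>2 * r\<close>: two of the involutions can be split off at a time by passing
  to an eigenspace of half the dimension.  The same divisibility bounds the Radon--Hurwitz number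
  from above.  The lower bound and the construction of totally symmetric EITFFs both come from the
  Jordan--Wigner matrices.\<close>

section \<open>Complex matrices\<close>

text \<open>\<open>*\<^sub>R\<close> gives only real multiples. Complex ones are written entrywise,
  in the same form as in \<open>scaled_unitary\<close>.\<close>

definition cscale :: "complex \<Rightarrow> complex^'n^'m \<Rightarrow> complex^'n^'m" (infixr "*\<^sub>C" 75)
  where "c *\<^sub>C A = (\<chi> i j. c * A $ i $ j)"

lemma matrix_mul_cscale:
  "(c *\<^sub>C A) ** B = c *\<^sub>C (A ** B)" "A ** (c *\<^sub>C B) = c *\<^sub>C (A ** B)"
  by (simp_all add: cscale_def matrix_matrix_mult_def vec_eq_iff sum_distrib_left mult_ac)

lemma cscale_vector_mult: "(c *\<^sub>C A) *v x = c *s (A *v x)"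
  by (simp add: cscale_def matrix_vector_mult_def vec_eq_iff sum_distrib_left mult_ac)

lemma cscale_simps [simp]:
  "c *\<^sub>C d *\<^sub>C A = (c * d) *\<^sub>C A" "c *\<^sub>C (A + B) = c *\<^sub>C A + c *\<^sub>C B"
  "c *\<^sub>C (A - B) = c *\<^sub>C A - c *\<^sub>C B" "c *\<^sub>C (- A) = - (c *\<^sub>C A)"
  "1 *\<^sub>C A = A" "(-1) *\<^sub>C A = - A" "(- c) *\<^sub>C A = - (c *\<^sub>C A)"
  by (simp_all add: cscale_def vec_eq_iff algebra_simps)

lemma cscale_of_real: "complex_of_real c *\<^sub>C A = c *\<^sub>R A"
  by (simp add: cscale_def vec_eq_iff complex_eq_iff)

lemma matrix_mul_minus:
  fixes A :: "complex^'n^'m" and B :: "complex^'p^'n"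
  shows "(- A) ** B = - (A ** B)" "A ** (- B) = - (A ** B)"
  by (simp_all add: matrix_matrix_mult_def vec_eq_iff sum_negf)

lemma matrix_add_rdistrib':
  fixes A B :: "complex^'n^'m" and C :: "complex^'p^'n"
  shows "(A + B) ** C = A ** C + B ** C"
  by (simp add: matrix_matrix_mult_def vec_eq_iff sum.distrib algebra_simps)

lemma matrix_mul_diff:
  fixes A B :: "complex^'n^'m" and C D :: "complex^'p^'n"
  shows "(A - B) ** C = A ** C - B ** C" "A ** (C - D) = A ** C - A ** D"
  by (simp_all add: matrix_matrix_mult_def vec_eq_iff sum_subtractf algebra_simps)

lemma matrix_mul_scaleR:
  fixes A :: "complex^'n^'m" and B :: "complex^'p^'n"
  shows "(c *\<^sub>R A) ** B = c *\<^sub>R (A ** B)" "A ** (c *\<^sub>R B) = c *\<^sub>R (A ** B)"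
  by (simp_all add: matrix_matrix_mult_def vec_eq_iff scaleR_sum_right)

lemma matrix_mul_sum:
  fixes A :: "'i \<Rightarrow> complex^'n^'m" and B :: "complex^'p^'n"
  shows "(\<Sum>i\<in>I. A i) ** B = (\<Sum>i\<in>I. A i ** B)"
  by (induction I rule: infinite_finite_induct) (simp_all add: matrix_add_rdistrib')

lemma matrix_mul_sum_right:
  fixes B :: "'i \<Rightarrow> complex^'p^'n" and A :: "complex^'n^'m"
  shows "A ** (\<Sum>i\<in>I. B i) = (\<Sum>i\<in>I. A ** B i)"
  by (induction I rule: infinite_finite_induct) (simp_all add: matrix_add_ldistrib)

lemmas matrix_distribs = matrix_mul_minus matrix_add_rdistrib' matrix_add_ldistrib
  matrix_mul_diff matrix_mul_scaleR matrix_mul_cscale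

lemma matrix_combination_mult:
  fixes X :: "'i \<Rightarrow> complex^'n^'m" and Y :: "'j \<Rightarrow> complex^'p^'n"
  shows "(\<Sum>i\<in>I. u i *\<^sub>R X i) ** (\<Sum>j\<in>J. v j *\<^sub>R Y j) = (\<Sum>i\<in>I. \<Sum>j\<in>J. (u i * v j) *\<^sub>R (X i ** Y j))"
  unfolding matrix_mul_sum by (simp add: matrix_mul_sum_right matrix_distribs scaleR_sum_right mult.commute)

lemma scaleR_matrix_vector_mult: "(c *\<^sub>R A) *v x = complex_of_real c *s (A *v x)"
  by (simp add: cscale_vector_mult flip: cscale_of_real)

lemma cadjoint_simps [simp]:
  "cadjoint (A + B) = cadjoint A + cadjoint B" "cadjoint (A - B) = cadjoint A - cadjoint B"
  "cadjoint (- A) = - cadjoint A" "cadjoint (c *\<^sub>C A) = cnj c *\<^sub>C cadjoint A"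
  "cadjoint (x *\<^sub>R A) = x *\<^sub>R cadjoint A" "cadjoint (mat 1) = mat 1"
  "cadjoint (cadjoint A) = A" "cadjoint 0 = 0"
  by (simp_all add: cadjoint_def cscale_def vec_eq_iff mat_def)

lemma cadjoint_mult: "cadjoint (A ** B) = cadjoint B ** cadjoint A"
  by (simp add: cadjoint_def matrix_matrix_mult_def vec_eq_iff mult.commute)

lemma cadjoint_sum: "cadjoint (\<Sum>i\<in>I. A i) = (\<Sum>i\<in>I. cadjoint (A i))"
  by (induction I rule: infinite_finite_induct) simp_all

lemma cinner_matrix_left: "cinner (A *v x) y = cinner x (cadjoint A *v y)"
proof -
  have "cinner (A *v x) y = (\<Sum>i\<in>UNIV. \<Sum>j\<in>UNIV. A $ i $ j * x $ j * cnj (y $ i))"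
    by (simp add: cinner_def matrix_vector_mult_def sum_distrib_right)
  also have "\<dots> = (\<Sum>j\<in>UNIV. \<Sum>i\<in>UNIV. A $ i $ j * x $ j * cnj (y $ i))"
    by (rule sum.swap)
  also have "\<dots> = cinner x (cadjoint A *v y)"
    by (simp add: cinner_def matrix_vector_mult_def cadjoint_def sum_distrib_left mult_ac)
  finally show ?thesis .
qed

section \<open>Anticommuting involutions\<close>

lemma matrix_vector_minus:
  fixes A :: "complex^'n^'m"
  shows "(- A) *v x = - (A *v x)" "A *v (- x) = - (A *v x)"
  by (simp_all add: matrix_vector_mult_def vec_eq_iff sum_negf)

text \<open>\<open>B\<close> maps the eigenspaces of \<open>A\<close> in \<open>S\<close> for 1 and
  -1 injectively into each other, so their dimensions agree; as \<open>A\<close> is an involution,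
  they decompose \<open>S\<close>.\<close>

lemma dim_eigenspace_half:
  fixes A B :: "complex^'n^'n"
  assumes S: "vec.subspace S" and A: "A ** A = mat 1" and B: "inj ((*v) B)"
    and anti: "B ** A = - (A ** B)"
    and AS: "\<And>x. x \<in> S \<Longrightarrow> A *v x \<in> S" and BS: "\<And>x. x \<in> S \<Longrightarrow> B *v x \<in> S"
  shows "vec.dim S = 2 * vec.dim {x \<in> S. A *v x = x}" and "vec.subspace {x \<in> S. A *v x = x}"
proof -
  define W V where "W = {x \<in> S. A *v x = x}" and "V = {x \<in> S. A *v x = - x}"
  have W: "vec.subspace W" and V: "vec.subspace V"
    using S unfolding W_def V_def vec.subspace_def
    by (auto simp: matrix_vector_right_distrib vector_scalar_commute)
  show "vec.subspace {x \<in> S. A *v x = x}" using W unfolding W_def .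
  have AA: "A *v (A *v x) = x" for x
    by (simp add: matrix_vector_mul_assoc A)
  have AB: "A *v (B *v x) = - (B *v (A *v x))" for x
    by (simp add: matrix_vector_mul_assoc anti matrix_vector_minus)
  have dimB: "vec.dim ((*v) B ` X) = vec.dim X" for X
    by (rule vec.dim_image_eq) (use B in \<open>auto intro: inj_on_subset\<close>)
  have "(*v) B ` W \<subseteq> V" "(*v) B ` V \<subseteq> W"
    using BS by (auto simp: W_def V_def AB matrix_vector_minus)
  then have "vec.dim W \<le> vec.dim V" "vec.dim V \<le> vec.dim W"
    using vec.dim_subset dimB by metis+
  then have eq: "vec.dim W = vec.dim V" by simp
  have "W \<inter> V \<subseteq> {0}"
  proof
    fix x assume "x \<in> W \<inter> V"
    then have "x = - x" unfolding W_def V_def by (metis (mono_tags, lifting) IntD1 IntD2 mem_Collect_eq)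
    then have "x $ i = - x $ i" for i by (metis vector_uminus_component)
    then show "x \<in> {0}" by (simp add: vec_eq_iff)
  qed
  then have int: "W \<inter> V = {0}"
    using W V vec.subspace_0 by blast
  have "{x + y |x y. x \<in> W \<and> y \<in> V} = S"
  proof (intro subset_antisym subsetI)
    fix z assume z: "z \<in> S"
    define x y where "x = (1/2) *s (z + A *v z)" and "y = (1/2) *s (z - A *v z)"
    have "A *v x = x" "A *v y = - y"
      by (simp_all add: x_def y_def vector_scalar_commute AA matrix_vector_right_distrib
          matrix_vector_mult_diff_distrib vec_eq_iff algebra_simps)
    moreover have "x \<in> S" "y \<in> S"
      unfolding x_def y_def using z S AS
      by (simp_all add: vec.subspace_scale vec.subspace_add vec.subspace_diff)
    ultimately have "x \<in> W" "y \<in> V" by (simp_all add: W_def V_def)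
    moreover have "z = x + y"
      by (simp add: x_def y_def vec_eq_iff field_simps)
    ultimately show "z \<in> {x + y |x y. x \<in> W \<and> y \<in> V}" by blast
  qed (use S vec.subspace_add in \<open>auto simp: W_def V_def\<close>)
  with vec.dim_sums_Int[OF W V] int eq show "vec.dim S = 2 * vec.dim {x \<in> S. A *v x = x}"
    by (simp add: W_def)
qed

lemma involution_inj: "A ** A = mat 1 \<Longrightarrow> inj ((*v) (A :: complex^'n^'n))"
  by (rule inj_on_inverseI[where g = "(*v) A"]) (simp add: matrix_vector_mul_assoc)

text \<open>For odd \<open>m\<close> the anticommuting involutions alone only force \<open>2 ^ (m div 2)\<close>: there are two
  inequivalent irreducible representations.  The operator \<open>Y\<close> interchanges them.\<close>

lemma anticommuting_dvd_dim:
  fixes E :: "nat \<Rightarrow> complex^'n^'n"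
  assumes "vec.subspace S"
    and "\<And>i. i < m \<Longrightarrow> E i ** E i = mat 1"
    and "\<And>i j. i < m \<Longrightarrow> j < m \<Longrightarrow> i \<noteq> j \<Longrightarrow> E i ** E j = - (E j ** E i)"
    and "\<And>i x. i < m \<Longrightarrow> x \<in> S \<Longrightarrow> E i *v x \<in> S"
    and "odd m \<Longrightarrow> inj ((*v) Y)" and "odd m \<Longrightarrow> Y ** E 0 = - (E 0 ** Y)"
    and "\<And>i. odd m \<Longrightarrow> 0 < i \<Longrightarrow> i < m \<Longrightarrow> Y ** E i = E i ** Y"
    and "\<And>x. odd m \<Longrightarrow> x \<in> S \<Longrightarrow> Y *v x \<in> S"
  shows "2 ^ ((m + 1) div 2) dvd vec.dim S"
  using assms
proof (induction m arbitrary: S E rule: induct_nat_012)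
  case 0
  show ?case by simp
next
  case 1
  have "vec.dim S = 2 * vec.dim {x \<in> S. E 0 *v x = x}"
    by (rule dim_eigenspace_half[where B = Y]) (use 1(1,2,4-6,8) in auto)
  then show ?case by simp
next
  case (ge2 m)
  define A B where "A = E (Suc m)" and "B = E m"
  have A: "A ** A = mat 1" and B: "B ** B = mat 1"
    using ge2.prems(2) unfolding A_def B_def by simp_all
  have AB: "B ** A = - (A ** B)"
    unfolding A_def B_def by (rule ge2.prems(3)) simp_all
  have AE: "E i ** A = - (A ** E i)" and BE: "E i ** B = - (B ** E i)" if "i < m" for i
    unfolding A_def B_def by (rule ge2.prems(3); use that in simp)+
  define W where "W = {x \<in> S. A *v x = x}"
  have half: "vec.dim S = 2 * vec.dim W" "vec.subspace W"
    using dim_eigenspace_half[OF ge2.prems(1) A involution_inj[OF B] AB] ge2.prems(4)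
    unfolding W_def A_def B_def by simp_all
  \<comment> \<open>\<open>B\<close> and \<open>E i\<close> both anticommute with \<open>A\<close>,
    so their product commutes with \<open>A\<close> and preserves \<open>W\<close>. The square of
    \<open>B ** E i\<close> is minus the identity, which the factor \<open>\<i>\<close>
    corrects.\<close>
  define F where "F i = \<i> *\<^sub>C (B ** E i)" for i
  have WI: "X *v x \<in> W" if "x \<in> W" "X ** A = A ** X" "\<And>x. x \<in> S \<Longrightarrow> X *v x \<in> S" for X x
    using that by (auto simp: W_def matrix_vector_mul_assoc) (metis matrix_vector_mul_assoc)
  have FF: "F i ** F j = E i ** E j" if "i < m" "j < m" for i j
  proof -
    have "F i ** F j = - (B ** ((E i ** B) ** E j))"
      by (simp add: F_def matrix_distribs matrix_mul_assoc)
    also have "\<dots> = (B ** B) ** (E i ** E j)"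
      using that by (simp add: BE matrix_distribs matrix_mul_assoc)
    finally show ?thesis by (simp add: B)
  qed
  have "2 ^ ((m + 1) div 2) dvd vec.dim W"
  proof (rule ge2.IH(1))
    show "vec.subspace W" by (rule half)
    show "F i ** F i = mat 1" if "i < m" for i
      using that FF ge2.prems(2) by simp
    show "F i ** F j = - (F j ** F i)" if "i < m" "j < m" "i \<noteq> j" for i j
      using that FF[of i j] FF[of j i] ge2.prems(3)[of i j] by simp
    show "F i *v x \<in> W" if i: "i < m" and "x \<in> W" for i x
    proof (rule WI)
      have "B ** E i ** A = A ** B ** E i"
        using i by (simp add: AE AB matrix_distribs matrix_mul_assoc flip: matrix_mul_assoc[of B])
      then show "F i ** A = A ** F i"
        by (simp add: F_def matrix_distribs matrix_mul_assoc)
      show "F i *v x \<in> S" if "x \<in> S" for x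
        using that i ge2.prems(1,4)
        by (simp add: F_def cscale_vector_mult vec.subspace_scale B_def flip: matrix_vector_mul_assoc)
    qed fact
    assume m: "odd m"
    then have Y: "Y ** E 0 = - (E 0 ** Y)" "\<And>i. 0 < i \<Longrightarrow> i < m + 2 \<Longrightarrow> Y ** E i = E i ** Y"
      using ge2.prems(6,7) by simp_all
    have m0: "m > 0" using m by (rule odd_pos)
    show "inj ((*v) Y)" using m ge2.prems(5) by simp
    \<comment> \<open>An odd \<open>m\<close> is positive, so \<open>B = E m\<close> is not the
      generator negated by \<open>Y\<close>, and \<open>F i\<close> behaves under \<open>Y\<close>
      as \<open>E i\<close> does.\<close>
    have YB: "Y ** (B ** X) = B ** (Y ** X)" for X
      using Y(2)[of m] m0 by (simp add: B_def matrix_mul_assoc)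
    show "Y ** F 0 = - (F 0 ** Y)"
      by (simp add: F_def matrix_distribs YB Y(1) flip: matrix_mul_assoc)
    show "Y ** F i = F i ** Y" if "0 < i" "i < m" for i
      using that by (simp add: F_def matrix_distribs YB Y(2) flip: matrix_mul_assoc)
    show "Y *v x \<in> W" if "x \<in> W" for x
      by (rule WI) (use that m ge2.prems(8) Y(2)[of "Suc m"] in \<open>simp_all add: A_def\<close>)
  qed
  then show ?case using half(1) by simp
qed

section \<open>Monomial matrices and the Jordan--Wigner construction\<close>

definition monomial_matrix :: "('n::finite \<Rightarrow> 'n) \<Rightarrow> ('n \<Rightarrow> complex) \<Rightarrow> complex^'n^'n"
  where "monomial_matrix \<pi> s = (\<chi> a b. if b = \<pi> a then s a else 0)"

text \<open>As an operator, \<open>monomial_matrix \<pi> s\<close> pulls a vector back along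
  \<open>\<pi>\<close> and then multiplies it entrywise by \<open>s\<close>; hence the index maps
  compose in reverse order.\<close>

lemma monomial_matrix_mult:
  "monomial_matrix \<pi> s ** monomial_matrix \<tau> t = monomial_matrix (\<tau> \<circ> \<pi>) (\<lambda>a. s a * t (\<pi> a))"
  by (simp add: monomial_matrix_def matrix_matrix_mult_def vec_eq_iff if_distrib[of "\<lambda>x. x * _"]
      cong: if_cong)

lemma cadjoint_monomial_matrix:
  assumes "\<And>a. \<pi> (\<pi> a) = a"
  shows "cadjoint (monomial_matrix \<pi> s) = monomial_matrix \<pi> (\<lambda>a. cnj (s (\<pi> a)))"
  using assms by (simp add: monomial_matrix_def cadjoint_def vec_eq_iff)

text \<open>The Jordan--Wigner matrices: identify the index type with \<open>k\<close> bits times a multiplicity, the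
  bits being recorded as a subset of \<open>{..<k}\<close>.  The matrices \<open>2 * j\<close> and \<open>2 * j + 1\<close> flip bit \<open>j\<close>,
  with a sign depending on the bits below \<open>j\<close>; the matrix \<open>2 * k\<close> flips nothing.\<close>

lemma anticommuting_hermitian_exist:
  assumes "2 ^ k dvd CARD('n::finite)"
  obtains G :: "nat \<Rightarrow> complex^'n^'n" where
    "\<And>p. p \<le> 2 * k \<Longrightarrow> cadjoint (G p) = G p"
    "\<And>p. p \<le> 2 * k \<Longrightarrow> G p ** G p = mat 1"
    "\<And>p q. p \<le> 2 * k \<Longrightarrow> q \<le> 2 * k \<Longrightarrow> p \<noteq> q \<Longrightarrow> G p ** G q = - (G q ** G p)"
proof -
  obtain N where N: "CARD('n) = 2 ^ k * N" using assms by blast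
  have "card (Pow {..<k} \<times> {..<N}) = CARD('n)"
    by (simp add: card_cartesian_product card_Pow N)
  then obtain h :: "'n \<Rightarrow> nat set \<times> nat" where h: "bij_betw h UNIV (Pow {..<k} \<times> {..<N})"
    by (metis finite_same_card_bij finite_class.finite_UNIV finite_Pow_iff finite_cartesian_product
        finite_lessThan)
  define bits where "bits a = fst (h a)" for a
  \<comment> \<open>Intersecting with \<open>{..<k}\<close> makes \<open>flip k\<close> the
    identity, so that the last matrix, which is diagonal, needs no separate definition.\<close>
  define flip where
    "flip j a = inv h (sym_diff (bits a) ({j} \<inter> {..<k}), snd (h a))" for j a
  have hmem: "h a \<in> Pow {..<k} \<times> {..<N}" for a using h bij_betwE by blast
  have hflip: "h (flip j a) = (sym_diff (bits a) ({j} \<inter> {..<k}), snd (h a))" for j a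
    unfolding flip_def
    by (rule bij_betw_inv_into_right[OF h]) (use hmem[of a] in \<open>auto simp: bits_def mem_Times_iff\<close>)
  have heq: "a = b" if "h a = h b" for a b
    using h that by (auto simp: bij_betw_def inj_on_def)
  have bits_flip: "bits (flip j a) = sym_diff (bits a) ({j} \<inter> {..<k})" for j a
    by (simp add: bits_def hflip)
  have flip2: "flip j (flip j a) = a" for j a
    by (rule heq) (auto simp: hflip bits_flip bits_def prod_eq_iff)
  have flip_comm: "flip i \<circ> flip j = flip j \<circ> flip i" for i j
    by (rule ext, rule heq) (auto simp: hflip bits_flip)
  \<comment> \<open>The sign string over the bits below \<open>j\<close>: it is reversed by flipping
    one of these bits and unaffected by flipping any other.\<close>
  define sg where "sg j a = (\<Prod>l<j. if l \<in> bits a then - 1 else (1::complex))" for j a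
  have sg: "sg j (flip i a) = (if i < j \<and> i < k then - sg j a else sg j a)" for i j a
  proof (cases "i < j \<and> i < k")
    case True
    then have "sg j b = (if i \<in> bits b then - 1 else 1)
        * (\<Prod>l\<in>{..<j} - {i}. if l \<in> bits b then - 1 else (1::complex))" for b
      unfolding sg_def by (intro prod.remove) auto
    moreover have "(\<Prod>l\<in>{..<j} - {i}. if l \<in> bits (flip i a) then - 1 else (1::complex))
        = (\<Prod>l\<in>{..<j} - {i}. if l \<in> bits a then - 1 else 1)"
      by (rule prod.cong) (auto simp: bits_flip)
    ultimately show ?thesis using True by (simp add: bits_flip)
  qed (auto simp: sg_def bits_flip intro!: prod.cong)
  have sg_sq: "sg j a * sg j a = 1" and sg_cnj: "cnj (sg j a) = sg j a" for j a
    by (auto simp: sg_def simp flip: prod.distrib intro!: prod.neutral prod.cong)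
  \<comment> \<open>Below \<open>2 * k\<close>, an even \<open>p\<close> puts the Pauli matrix X and
    an odd \<open>p\<close> the Pauli matrix Y on bit \<open>p div 2\<close>. At
    \<open>p = 2 * k\<close> only the full string remains, the product of all Pauli matrices
    Z.\<close>
  define ph where "ph p a = sg (p div 2) a
      * (if odd p then (if p div 2 \<in> bits a then \<i> else - \<i>) else 1)" for p a
  define G where "G p = monomial_matrix (flip (p div 2)) (ph p)" for p
  \<comment> \<open>For odd \<open>p\<close> the bound gives \<open>p div 2 < k\<close>, so the bit
    is really flipped and its factor turns into the conjugate.\<close>
  have ph_flip: "cnj (ph p (flip (p div 2) a)) = ph p a" if "p \<le> 2 * k" for p a
    using that by (auto simp: ph_def sg sg_cnj bits_flip elim!: oddE)
  have ph_sq: "ph p a * cnj (ph p a) = 1" for p a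
    using sg_sq[of "p div 2" a] by (auto simp: ph_def sg_cnj algebra_simps)
  have adj: "cadjoint (G p) = G p" if "p \<le> 2 * k" for p
    using that by (simp add: G_def cadjoint_monomial_matrix flip2 ph_flip)
  have sq: "G p ** G p = mat 1" if "p \<le> 2 * k" for p
  proof -
    have "ph p a * ph p (flip (p div 2) a) = 1" for a
      using ph_flip[OF that, of "flip (p div 2) a"] ph_sq[of p a] by (simp add: flip2)
    then show ?thesis
      unfolding G_def monomial_matrix_mult
      by (auto simp: monomial_matrix_def mat_def vec_eq_iff flip2)
  qed
  have anti: "G p ** G q = - (G q ** G p)" if "p < q" "q \<le> 2 * k" for p q
  proof -
    have "ph p a * ph q (flip (p div 2) a) = - (ph q a * ph p (flip (q div 2) a))" for a
    \<comment> \<open>On a common bit, the factor \<open>\<i>\<close> or \<open>-\<i>\<close> of the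
      odd index changes sign under the flip; on different bits, only the sign string of the larger
      index does.\<close>
    proof (cases "p div 2 = q div 2")
      case True
      then have "even p" "q = Suc p" using that(1) by presburger+
      then show ?thesis using that(2) by (auto simp: ph_def sg bits_flip elim!: evenE)
    next
      case False
      then have "p div 2 < q div 2" "p div 2 < k" using that by auto
      then show ?thesis by (auto simp: ph_def sg bits_flip)
    qed
    then show ?thesis
      unfolding G_def monomial_matrix_mult flip_comm[of "q div 2"]
      by (simp add: monomial_matrix_def vec_eq_iff)
  qed
  show thesis
  proof (rule that)
    show "G p ** G q = - (G q ** G p)" if "p \<le> 2 * k" "q \<le> 2 * k" "p \<noteq> q" for p q
      using that anti[of p q] anti[of q p] by (cases "p < q") auto
  qed (use adj sq in auto)
qed

section \<open>The Radon--Hurwitz number\<close>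

text \<open>Identifies the real inner product with the Frobenius one, so that taking traces turns
  scalar matrix identities into norms.\<close>

lemma inner_matrix_trace: "inner A B = Re (trace (cadjoint A ** B))"
proof -
  have "inner A B = (\<Sum>i\<in>UNIV. \<Sum>j\<in>UNIV. Re (cnj (A $ i $ j) * B $ i $ j))"
    by (simp add: inner_vec_def inner_complex_def)
  also have "\<dots> = (\<Sum>j\<in>UNIV. \<Sum>i\<in>UNIV. Re (cnj (A $ i $ j) * B $ i $ j))"
    by (rule sum.swap)
  also have "\<dots> = Re (trace (cadjoint A ** B))"
    by (simp add: trace_def matrix_matrix_mult_def cadjoint_def)
  finally show ?thesis .
qed

lemma inner_scaleR_mat_1: "Re (trace (c *\<^sub>R mat 1 :: complex^'n^'n)) = c * CARD('n)"
  by (simp add: trace_def mat_def)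

text \<open>The scalar loses its phase: \<open>c\<close> is its squared modulus, and conversely
  \<open>sqrt c\<close> serves as the scalar. For \<open>c = 0\<close> the matrix has norm zero and
  vanishes.\<close>

lemma scaled_unitary_iff:
  fixes A :: "complex^'n^'n"
  shows "scaled_unitary A \<longleftrightarrow> (\<exists>c\<ge>0. cadjoint A ** A = c *\<^sub>R mat 1 \<and> A ** cadjoint A = c *\<^sub>R mat 1)"
proof
  assume "scaled_unitary A"
  then obtain c U where U: "unitary_matrix U" and A: "A = c *\<^sub>C U"
    by (auto simp: scaled_unitary_def cscale_def)
  have "cnj c * c = complex_of_real ((cmod c)\<^sup>2)" "c * cnj c = complex_of_real ((cmod c)\<^sup>2)"
    by (simp_all add: complex_norm_square mult.commute del: of_real_power)
  then show "\<exists>c\<ge>0. cadjoint A ** A = c *\<^sub>R mat 1 \<and> A ** cadjoint A = c *\<^sub>R mat 1"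
    using U by (intro exI[of _ "(cmod c)\<^sup>2"])
      (simp add: A matrix_mul_cscale unitary_matrix_def cscale_of_real del: of_real_power)
next
  assume "\<exists>c\<ge>0. cadjoint A ** A = c *\<^sub>R mat 1 \<and> A ** cadjoint A = c *\<^sub>R mat 1"
  then obtain c where c: "c \<ge> 0" "cadjoint A ** A = c *\<^sub>R mat 1" "A ** cadjoint A = c *\<^sub>R mat 1"
    by blast
  show "scaled_unitary A"
  proof (cases "c = 0")
    case True
    then have "inner A A = 0" by (simp add: inner_matrix_trace c trace_def)
    then have "A = 0 *\<^sub>C mat 1" by (simp add: cscale_def vec_eq_iff)
    then show ?thesis
      by (auto simp: scaled_unitary_def cscale_def unitary_matrix_def
          intro!: exI[of _ 0] exI[of _ "mat 1"])
  next
    case False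
    define U where "U = (1 / sqrt c) *\<^sub>R A"
    have "unitary_matrix U"
      using c False by (simp add: unitary_matrix_def U_def matrix_mul_scaleR)
    moreover have "A = complex_of_real (sqrt c) *\<^sub>C U"
      using c False by (simp add: U_def cscale_of_real)
    ultimately show ?thesis by (auto simp: scaled_unitary_def cscale_def)
  qed
qed

lemma scaled_unitary_norm:
  fixes A :: "complex^'n^'n"
  assumes "scaled_unitary A"
  shows "cadjoint A ** A = (inner A A / CARD('n)) *\<^sub>R mat 1"
    and "A ** cadjoint A = (inner A A / CARD('n)) *\<^sub>R mat 1"
proof -
  obtain c where c: "cadjoint A ** A = c *\<^sub>R mat 1" "A ** cadjoint A = c *\<^sub>R mat 1"
    using assms scaled_unitary_iff by blast
  have "inner A A = c * CARD('n)"
    unfolding inner_matrix_trace c by (rule inner_scaleR_mat_1)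
  then show "cadjoint A ** A = (inner A A / CARD('n)) *\<^sub>R mat 1"
    and "A ** cadjoint A = (inner A A / CARD('n)) *\<^sub>R mat 1"
    using c by simp_all
qed

text \<open>Polarizes \<open>scaled_unitary_norm\<close>: orthogonal members of a space of scaled
  unitaries satisfy the Radon--Hurwitz relations.\<close>

lemma scaled_unitary_polarization:
  fixes A B :: "complex^'n^'n"
  assumes "scaled_unitary A" "scaled_unitary B" "scaled_unitary (A + B)"
  shows "cadjoint A ** B + cadjoint B ** A = (2 * inner A B / CARD('n)) *\<^sub>R mat 1"
proof -
  have "cadjoint A ** B + cadjoint B ** A
      = cadjoint (A + B) ** (A + B) - cadjoint A ** A - cadjoint B ** B"
    by (simp add: matrix_distribs)
  also have "\<dots> = (2 * inner A B / CARD('n)) *\<^sub>R mat 1"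
    unfolding scaled_unitary_norm(1)[OF assms(1)] scaled_unitary_norm(1)[OF assms(2)]
      scaled_unitary_norm(1)[OF assms(3)] scaleR_diff_left[symmetric]
    by (rule arg_cong[where f = "\<lambda>c. c *\<^sub>R _"])
      (simp add: inner_add_left inner_add_right inner_commute field_simps)
  finally show ?thesis .
qed

text \<open>A rescaled orthonormal basis consists of unitaries with the Radon--Hurwitz relations.
  Dividing by one of them turns the others into anticommuting involutions, and
  \<open>2 * k + 2\<close> of these would force \<open>2 ^ (k + 1)\<close> to divide
  \<open>CARD('r)\<close>.\<close>

lemma dim_scaled_unitary_le:
  fixes V :: "(complex^'r^'r) set"
  assumes V: "subspace V" and su: "\<And>A. A \<in> V \<Longrightarrow> scaled_unitary A"
    and r: "CARD('r) = N * 2 ^ k" "odd N"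
  shows "dim V \<le> 2 * k + 2"
proof (rule ccontr)
  assume "\<not> dim V \<le> 2 * k + 2"
  then have d: "2 * k + 3 \<le> dim V" by simp
  obtain B where B: "B \<subseteq> V" "pairwise orthogonal B" "\<And>x. x \<in> B \<Longrightarrow> norm x = 1"
      "independent B" "card B = dim V"
    using orthonormal_basis_subspace[OF V] by metis
  obtain C' where "bij_betw C' {..<dim V} B"
    using B(4,5) independent_imp_finite bij_betw_from_nat_into_finite ex_bij_betw_nat_finite
    by (metis atLeast0LessThan)
  then have C': "\<And>i. i < dim V \<Longrightarrow> C' i \<in> B" "\<And>i j. i < dim V \<Longrightarrow> j < dim V \<Longrightarrow> C' i = C' j \<Longrightarrow> i = j"
    by (auto simp: bij_betw_def inj_on_def)
  \<comment> \<open>Unitary matrices have Frobenius norm \<open>sqrt CARD('r)\<close>, whence the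
    factor.\<close>
  define C where "C i = sqrt CARD('r) *\<^sub>R C' i" for i
  have inn: "inner (C i) (C j) = (if i = j then CARD('r) else 0)" if "i < dim V" "j < dim V" for i j
  proof (cases "i = j")
    case False
    then have "inner (C' i) (C' j) = 0"
      using that B(2) C' unfolding pairwise_def orthogonal_def by metis
    then show ?thesis using False by (simp add: C_def)
  qed (use that B(3) C'(1) in \<open>auto simp: C_def simp flip: power2_norm_eq_inner\<close>)
  have CV: "C i \<in> V" if "i < dim V" for i
    using that C'(1) B(1) V subspace_scale unfolding C_def by blast
  have C1: "cadjoint (C i) ** C i = mat 1" "C i ** cadjoint (C i) = mat 1" if "i < dim V" for i
    using scaled_unitary_norm[OF su[OF CV[OF that]]] inn[OF that that] by simp_all
  have C2: "cadjoint (C i) ** C j = - (cadjoint (C j) ** C i)"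
    if "i < dim V" "j < dim V" "i \<noteq> j" for i j
    using scaled_unitary_polarization[of "C i" "C j"] that inn[of i j] CV su V
    by (simp add: subspace_add eq_neg_iff_add_eq_0)
  \<comment> \<open>The shift skips \<open>C 0\<close>. By the relations,
    \<open>cadjoint (C 0) ** C (Suc i)\<close> squares to minus the identity; \<open>\<i>\<close>
    corrects the sign.\<close>
  define E where "E i = \<i> *\<^sub>C (cadjoint (C 0) ** C (Suc i))" for i
  have EE: "E i ** E j = cadjoint (C (Suc i)) ** C (Suc j)"
    if ij: "Suc i < dim V" "Suc j < dim V" for i j
  proof -
    have "E i ** E j = - ((cadjoint (C 0) ** C (Suc i)) ** (cadjoint (C 0) ** C (Suc j)))"
      by (simp add: E_def matrix_distribs)
    also have "\<dots> = cadjoint (C (Suc i)) ** (C 0 ** cadjoint (C 0)) ** C (Suc j)"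
      using ij d by (subst C2) (simp_all add: matrix_distribs matrix_mul_assoc)
    finally show ?thesis using d C1(2)[of 0] by simp
  qed
  \<comment> \<open>Of at least \<open>2 * k + 3\<close> unitaries one serves as \<open>C 0\<close>.
    Taking the even number \<open>2 * k + 2\<close> of the rest makes the hypotheses on
    \<open>Y\<close> vacuous.\<close>
  have "2 ^ ((2 * (k + 1) + 1) div 2) dvd vec.dim (UNIV :: (complex^'r) set)"
  proof (rule anticommuting_dvd_dim)
    show "E i ** E i = mat 1" if "i < 2 * (k + 1)" for i
      using that d EE C1 by simp
    show "E i ** E j = - (E j ** E i)" if "i < 2 * (k + 1)" "j < 2 * (k + 1)" "i \<noteq> j" for i j
      using that d EE[of i j] EE[of j i] C2[of "Suc i" "Suc j"] by simp
  qed simp_all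
  then have "2 * 2 ^ k dvd N * 2 ^ k" unfolding vec_dim_card r by simp
  then show False using r(2) by simp
qed

text \<open>The extremal subspace is spanned by the identity and \<open>\<i>\<close> times the matrices of
  \<^term>\<open>anticommuting_hermitian_exist\<close>.\<close>

lemma scaled_unitary_subspace_exists:
  assumes "2 ^ k dvd CARD('r::finite)"
  obtains V :: "(complex^'r^'r) set" where
    "subspace V" "\<And>A. A \<in> V \<Longrightarrow> scaled_unitary A" "dim V = 2 * k + 2"
proof -
  obtain G :: "nat \<Rightarrow> complex^'r^'r" where G:
    "\<And>p. p \<le> 2 * k \<Longrightarrow> cadjoint (G p) = G p"
    "\<And>p. p \<le> 2 * k \<Longrightarrow> G p ** G p = mat 1"
    "\<And>p q. p \<le> 2 * k \<Longrightarrow> q \<le> 2 * k \<Longrightarrow> p \<noteq> q \<Longrightarrow> G p ** G q = - (G q ** G p)"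
    using anticommuting_hermitian_exist[OF assms] by metis
  define C where "C p = (case p of 0 \<Rightarrow> mat 1 | Suc q \<Rightarrow> \<i> *\<^sub>C G q)" for p
  define I where "I = {..<2 * k + 2}"
  have rel: "cadjoint (C p) ** C q + cadjoint (C q) ** C p = (if p = q then 2 else 0) *\<^sub>R mat 1"
      "C p ** cadjoint (C q) + C q ** cadjoint (C p) = (if p = q then 2 else 0) *\<^sub>R mat 1"
    if "p \<in> I" "q \<in> I" for p q
    using that G(1,2) G(3)[of "p - 1" "q - 1"]
    by (auto simp: C_def I_def matrix_distribs scaleR_2 split: nat.splits)
  define L where "L a = (\<Sum>p\<in>I. a p *\<^sub>R C p)" for a
  have sq: "cadjoint (L a) ** L a = (\<Sum>p\<in>I. (a p)\<^sup>2) *\<^sub>R mat 1"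
      "L a ** cadjoint (L a) = (\<Sum>p\<in>I. (a p)\<^sup>2) *\<^sub>R mat 1" for a
  proof -
    have fin: "finite I" by (simp add: I_def)
    \<comment> \<open>Only the symmetrized products are known, so the double sum is added to its
      transpose and the result halved.\<close>
    have *: "(\<Sum>p\<in>I. \<Sum>q\<in>I. (a p * a q) *\<^sub>R M p q) = (\<Sum>p\<in>I. (a p)\<^sup>2) *\<^sub>R (mat 1 :: complex^'r^'r)"
      if M: "\<And>p q. p \<in> I \<Longrightarrow> q \<in> I \<Longrightarrow> M p q + M q p = (if p = q then 2 else 0) *\<^sub>R mat 1"
      for M :: "nat \<Rightarrow> nat \<Rightarrow> complex^'r^'r"
    proof -
      let ?S = "\<Sum>p\<in>I. \<Sum>q\<in>I. (a p * a q) *\<^sub>R M p q"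
      have "2 *\<^sub>R ?S = ?S + (\<Sum>p\<in>I. \<Sum>q\<in>I. (a q * a p) *\<^sub>R M q p)"
        by (subst (2) sum.swap) (simp add: scaleR_2)
      also have "\<dots> = (\<Sum>p\<in>I. \<Sum>q\<in>I. (a p * a q) *\<^sub>R (M p q + M q p))"
        by (simp add: sum.distrib[symmetric] scaleR_add_right mult.commute)
      also have "\<dots> = (\<Sum>p\<in>I. \<Sum>q\<in>I. if p = q then (2 * (a p)\<^sup>2) *\<^sub>R mat 1 else 0)"
        using M by (intro sum.cong) (auto simp: power2_eq_square)
      also have "\<dots> = 2 *\<^sub>R ((\<Sum>p\<in>I. (a p)\<^sup>2) *\<^sub>R mat 1)"
        using fin by (simp add: scaleR_sum_left scaleR_sum_right)
      finally show ?thesis by (subst (asm) scaleR_cancel_left) simp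
    qed
    show "cadjoint (L a) ** L a = (\<Sum>p\<in>I. (a p)\<^sup>2) *\<^sub>R mat 1"
      using *[of "\<lambda>p q. cadjoint (C p) ** C q"] rel
      by (simp add: L_def cadjoint_sum matrix_combination_mult)
    show "L a ** cadjoint (L a) = (\<Sum>p\<in>I. (a p)\<^sup>2) *\<^sub>R mat 1"
      using *[of "\<lambda>p q. C p ** cadjoint (C q)"] rel
      by (simp add: L_def cadjoint_sum matrix_combination_mult)
  qed
  \<comment> \<open>The scalar belonging to \<open>L a\<close> is the squared length of
    \<open>a\<close>; this yields both the independence of the \<open>C p\<close> and their
    distinctness.\<close>
  have L0: "a p = 0" if "L a = 0" "p \<in> I" for a p
  proof -
    have "(\<Sum>p\<in>I. (a p)\<^sup>2) *\<^sub>R (mat 1 :: complex^'r^'r) = 0"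
      using sq[of a] that(1) by simp
    moreover have "(mat 1 :: complex^'r^'r) \<noteq> 0" by (simp add: mat_def vec_eq_iff)
    ultimately have "(\<Sum>p\<in>I. (a p)\<^sup>2) = 0" by simp
    then show ?thesis using that(2) by (subst (asm) sum_nonneg_eq_0_iff) (auto simp: I_def)
  qed
  have inj: "inj_on C I"
  proof (rule inj_onI, rule ccontr)
    fix p q assume pq: "p \<in> I" "q \<in> I" "C p = C q" "p \<noteq> q"
    define a where "a i = (if i = p then 1 else if i = q then - 1 else 0 :: real)" for i
    have "L a = (\<Sum>i\<in>{p, q}. a i *\<^sub>R C i)"
      unfolding L_def using pq by (intro sum.mono_neutral_right) (auto simp: a_def I_def)
    also have "\<dots> = 0" using pq by (simp add: a_def)
    finally show False using L0[of a p] pq by (simp add: a_def)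
  qed
  have fin: "finite (C ` I)" by (simp add: I_def)
  have sumL: "(\<Sum>v\<in>C ` I. u v *\<^sub>R v) = L (u \<circ> C)" for u
    unfolding L_def by (subst sum.reindex[OF inj]) simp
  have indep: "independent (C ` I)"
    using L0 fin by (intro independent_if_scalars_zero) (auto simp: sumL comp_def)
  show thesis
  proof (rule that)
    show "subspace (span (C ` I))" by simp
    show "scaled_unitary A" if A: "A \<in> span (C ` I)" for A
    proof -
      obtain u where "A = L u" using A unfolding span_finite[OF fin] by (auto simp: sumL)
      then show ?thesis
        using sq[of u] by (auto simp: scaled_unitary_iff intro!: exI[of _ "\<Sum>p\<in>I. (u p)\<^sup>2"] sum_nonneg)
    qed
    show "dim (span (C ` I)) = 2 * k + 2"
      using indep by (simp add: dim_eq_card_independent card_image[OF inj]) (simp add: I_def)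
  qed
qed

lemma radon_hurwitz_complex_eq:
  assumes "CARD('r::finite) = N * 2 ^ k" "odd N"
  shows "radon_hurwitz_complex TYPE('r) = 2 * k + 2"
  unfolding radon_hurwitz_complex_def
proof (rule Max_eqI)
  show "finite {dim V |V :: (complex^'r^'r) set. subspace V \<and> (\<forall>A\<in>V. scaled_unitary A)}"
    by (rule radon_hurwitz_complex_set)
  show "d \<le> 2 * k + 2"
    if "d \<in> {dim V |V :: (complex^'r^'r) set. subspace V \<and> (\<forall>A\<in>V. scaled_unitary A)}" for d
    using that dim_scaled_unitary_le[OF _ _ assms] by auto
  have "2 ^ k dvd CARD('r)" using assms by simp
  then obtain V :: "(complex^'r^'r) set" where
    "subspace V" "\<And>A. A \<in> V \<Longrightarrow> scaled_unitary A" "dim V = 2 * k + 2"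
    using scaled_unitary_subspace_exists by metis
  then show "2 * k + 2 \<in> {dim V |V :: (complex^'r^'r) set. subspace V \<and> (\<forall>A\<in>V. scaled_unitary A)}"
    by (intro CollectI exI[of _ V]) simp
qed

section \<open>From frames to anticommuting involutions\<close>

lemma cnj_cinner: "cnj (cinner x y) = cinner y x"
  by (simp add: cinner_def mult.commute)

lemma cinner_diff_right: "cinner z (x - y) = cinner z x - cinner z y"
  by (metis cnj_cinner cinner_diff_left complex_cnj_diff)

lemma orth_proj_fixes: "vec.subspace S \<Longrightarrow> x \<in> S \<Longrightarrow> orth_proj S *v x = x"
  by (rule orth_decomp_unique[of S _ x]) (simp_all add: orth_proj_works, simp add: cinner_def)

lemma orth_proj_idem: "vec.subspace S \<Longrightarrow> orth_proj S ** orth_proj S = orth_proj S"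
  by (simp add: matrix_eq orth_proj_fixes orth_proj_works(1) flip: matrix_vector_mul_assoc)

lemma orth_proj_hermitian:
  assumes S: "vec.subspace S"
  shows "cadjoint (orth_proj S) = orth_proj S"
proof -
  let ?P = "orth_proj S"
  have *: "cinner (?P *v x) (?P *v y) = cinner x (?P *v y)" for x y
    using orth_proj_works(2)[OF S orth_proj_works(1)[OF S], of x y]
    by (simp add: cinner_diff_left)
  have "cadjoint ?P *v y = ?P *v y" for y
  proof -
    have "cinner x (cadjoint ?P *v y - ?P *v y) = 0" for x
      using *[of x y] arg_cong[OF *[of y x], of cnj]
      by (simp add: cinner_diff_right cnj_cinner flip: cinner_matrix_left)
    then show ?thesis using cinner_self_eq_0 by fastforce
  qed
  then show ?thesis by (simp add: matrix_eq)
qed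

lemma orth_proj_range:
  assumes "P ** P = P" "cadjoint P = P"
  shows "vec.subspace (range ((*v) P))" and "orth_proj (range ((*v) P)) = P"
proof -
  show S: "vec.subspace (range ((*v) P))"
    unfolding vec.subspace_def
    by (auto simp flip: matrix_vector_right_distrib vector_scalar_commute
        intro!: image_eqI[where x = 0])
  have "cinner (x - P *v x) (P *v z) = 0" for x z
    using cinner_matrix_left[of P "x - P *v x" z] assms
    by (simp add: matrix_vector_mult_diff_distrib matrix_vector_mul_assoc) (simp add: cinner_def)
  then show "orth_proj (range ((*v) P)) = P"
    unfolding orth_proj_def by (intro the1_equality orth_proj_ex1[OF S]) auto
qed

text \<open>Anticommutators define a symmetric bilinear form on the span. The constant
  \<open>a\<close> enters only through the coefficient sums, so it drops out for contrasts.\<close>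

lemma anticommutator_combination:
  fixes X :: "'i \<Rightarrow> complex^'n^'n"
  assumes I: "finite I"
    and X: "\<And>i j. i \<in> I \<Longrightarrow> j \<in> I \<Longrightarrow> X i ** X j + X j ** X i = (a + (if i = j then b else 0)) *\<^sub>R mat 1"
  shows "(\<Sum>i\<in>I. u i *\<^sub>R X i) ** (\<Sum>i\<in>I. v i *\<^sub>R X i) + (\<Sum>i\<in>I. v i *\<^sub>R X i) ** (\<Sum>i\<in>I. u i *\<^sub>R X i)
    = (a * sum u I * sum v I + b * (\<Sum>i\<in>I. u i * v i)) *\<^sub>R mat 1"
proof -
  have "(\<Sum>i\<in>I. v i *\<^sub>R X i) ** (\<Sum>i\<in>I. u i *\<^sub>R X i)
      = (\<Sum>i\<in>I. \<Sum>j\<in>I. (u i * v j) *\<^sub>R (X j ** X i))"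
    unfolding matrix_combination_mult by (subst sum.swap) (simp add: mult.commute)
  moreover have "(\<Sum>i\<in>I. u i *\<^sub>R X i) ** (\<Sum>i\<in>I. v i *\<^sub>R X i)
      = (\<Sum>i\<in>I. \<Sum>j\<in>I. (u i * v j) *\<^sub>R (X i ** X j))"
    by (rule matrix_combination_mult)
  ultimately have "(\<Sum>i\<in>I. u i *\<^sub>R X i) ** (\<Sum>i\<in>I. v i *\<^sub>R X i)
        + (\<Sum>i\<in>I. v i *\<^sub>R X i) ** (\<Sum>i\<in>I. u i *\<^sub>R X i)
      = (\<Sum>i\<in>I. \<Sum>j\<in>I. (u i * v j) *\<^sub>R (X i ** X j + X j ** X i))"
    by (simp only: sum.distrib scaleR_add_right)
  also have "\<dots> = (\<Sum>i\<in>I. \<Sum>j\<in>I. (a * (u i * v j) + (if i = j then b * (u i * v j) else 0)) *\<^sub>R mat 1)"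
    using X by (intro sum.cong) (simp_all add: algebra_simps)
  also have "\<dots> = (\<Sum>i\<in>I. \<Sum>j\<in>I. a * (u i * v j) + (if i = j then b * (u i * v j) else 0)) *\<^sub>R mat 1"
    by (simp add: scaleR_sum_left)
  also have "(\<Sum>i\<in>I. \<Sum>j\<in>I. a * (u i * v j) + (if i = j then b * (u i * v j) else 0))
      = a * sum u I * sum v I + b * (\<Sum>i\<in>I. u i * v i)"
    using I by (simp add: sum.distrib sum_product sum_distrib_left mult_ac)
  finally show ?thesis .
qed

text \<open>\<open>A ** A\<close> equals \<open>cadjoint A ** A\<close>, the real part of whose
  trace is the squared Frobenius norm.\<close>

lemma hermitian_square_zero:
  fixes A :: "complex^'n^'n"
  assumes "cadjoint A = A" "A ** A = 0"
  shows "A = 0"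
proof -
  have "inner A A = 0" using assms by (simp add: inner_matrix_trace trace_def)
  then show ?thesis by simp
qed

text \<open>Both projections satisfy \<open>P ** D = (1 - s) *\<^sub>R P\<close> for \<open>D\<close> the square of their difference, so
  \<open>D\<close> is scalar on the sum of their ranges, which is everything by dimension.\<close>

lemma isoclinic_projections:
  fixes S T :: "(complex^'d) set"
  assumes S: "vec.subspace S" and T: "vec.subspace T"
    and dims: "vec.dim S + vec.dim T = CARD('d)"
    and P: "P = orth_proj S" and Q: "Q = orth_proj T"
    and PQP: "P ** Q ** P = s *\<^sub>R P" and QPQ: "Q ** P ** Q = s *\<^sub>R Q" and ne: "P \<noteq> Q"
  shows "s < 1" and "P + Q - P ** Q - Q ** P = (1 - s) *\<^sub>R mat 1"
proof -
  define D where "D = P + Q - P ** Q - Q ** P"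
  have idem: "P ** P = P" "Q ** Q = Q" and herm: "cadjoint P = P" "cadjoint Q = Q"
    using S T by (simp_all add: P Q orth_proj_idem orth_proj_hermitian)
  have D_sq: "D = (P - Q) ** (P - Q)"
    by (simp add: D_def matrix_distribs idem)
  have D_herm: "cadjoint D = D"
    by (simp add: D_def cadjoint_mult herm)
  have DP: "D ** P = (1 - s) *\<^sub>R P" and DQ: "D ** Q = (1 - s) *\<^sub>R Q"
    using PQP QPQ
    by (simp_all add: D_def matrix_distribs idem matrix_mul_assoc[symmetric] scaleR_diff_left)
  \<comment> \<open>For \<open>s = 1\<close> the matrix \<open>D\<close> annihilates
    \<open>P\<close> and \<open>Q\<close>, hence squares to zero and vanishes; then so does
    \<open>P - Q\<close>.\<close>
  have s1: "s \<noteq> 1"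
  proof
    assume "s = 1"
    then have "D ** P = 0" "D ** Q = 0" using DP DQ by simp_all
    then have "D ** D = 0"
      by (subst (2) D_def) (simp add: matrix_distribs matrix_mul_assoc)
    then have "D = 0" using D_herm hermitian_square_zero by blast
    then have "(P - Q) ** (P - Q) = 0" using D_sq by metis
    then have "P - Q = 0" by (rule hermitian_square_zero[rotated]) (simp add: herm)
    then show False using ne by simp
  qed
  have "S \<inter> T \<subseteq> {0}"
  proof
    fix x assume x: "x \<in> S \<inter> T"
    then have "P *v x = x" "Q *v x = x" using S T by (simp_all add: P Q orth_proj_fixes)
    then have "x = (P ** Q ** P) *v x" by (simp flip: matrix_vector_mul_assoc)
    also have "\<dots> = complex_of_real s *s x"
      unfolding PQP by (simp add: \<open>P *v x = x\<close> scaleR_matrix_vector_mult)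
    finally have "x $ i = complex_of_real s * x $ i" for i
      by (metis vector_smult_component)
    then show "x \<in> {0}" using s1 by (auto simp: vec_eq_iff)
  qed
  then have int: "S \<inter> T = {0}" using S T vec.subspace_0 by blast
  have sub: "vec.subspace {x + y |x y. x \<in> S \<and> y \<in> T}"
    using S T by (rule vec.subspace_sums)
  have "vec.dim {x + y |x y. x \<in> S \<and> y \<in> T} = CARD('d)"
    using vec.dim_sums_Int[OF S T] dims int by simp
  then have "{x + y |x y. x \<in> S \<and> y \<in> T} = UNIV"
    by (intro vec.subspace_dim_equal[OF sub vec.subspace_UNIV]) (simp, unfold vec_dim_card, simp)
  then have full: "\<exists>x\<in>S. \<exists>y\<in>T. z = x + y" for z by blast
  show D: "P + Q - P ** Q - Q ** P = (1 - s) *\<^sub>R mat 1"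
    unfolding D_def[symmetric] matrix_eq
  proof
    fix z
    obtain x y where xy: "x \<in> S" "y \<in> T" "z = x + y" using full by blast
    then have "P *v x = x" "Q *v y = y" using S T by (simp_all add: P Q orth_proj_fixes)
    then have "D *v z = (D ** P) *v x + (D ** Q) *v y"
      by (simp add: xy(3) matrix_vector_right_distrib flip: matrix_vector_mul_assoc)
    also have "\<dots> = ((1 - s) *\<^sub>R mat 1) *v z"
      unfolding DP DQ
      by (simp add: xy(3) \<open>P *v x = x\<close> \<open>Q *v y = y\<close> scaleR_matrix_vector_mult vec.scale_right_distrib)
    finally show "D *v z = ((1 - s) *\<^sub>R mat 1) *v z" .
  qed
  \<comment> \<open>The squared norm of \<open>P - Q\<close> is the trace of \<open>D\<close>, so
    \<open>1 - s\<close> cannot be negative.\<close>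
  have "inner (P - Q) (P - Q) = Re (trace D)"
    by (simp add: inner_matrix_trace D_sq herm)
  also have "\<dots> = (1 - s) * CARD('d)"
    using D unfolding D_def[symmetric] by (simp add: inner_scaleR_mat_1)
  finally have "0 \<le> (1 - s) * CARD('d)" by (metis inner_ge_zero)
  then have "s \<le> 1" by (simp add: zero_le_mult_iff)
  then show "s < 1" using s1 by simp
qed

text \<open>Helmert contrasts turn the vertices of a regular simplex into an orthogonal system.\<close>

definition helmert :: "nat \<Rightarrow> nat \<Rightarrow> real"
  where "helmert j i = (if i \<le> j + 1 then 1 else if i = j + 2 then - (real j + 1) else 0)"

lemma sum_helmert_mult:
  assumes "j + 2 \<le> n"
  shows "(\<Sum>i=1..n. helmert j i * f i) = (\<Sum>i=1..j+1. f i) - (real j + 1) * f (j + 2)"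
proof -
  have "(\<Sum>i=1..n. helmert j i * f i) = (\<Sum>i=1..Suc (j+1). helmert j i * f i)"
    using assms by (intro sum.mono_neutral_right) (auto simp: helmert_def)
  also have "\<dots> = (\<Sum>i=1..j+1. helmert j i * f i) - (real j + 1) * f (j + 2)"
    by (subst sum.cl_ivl_Suc) (simp add: helmert_def algebra_simps)
  also have "(\<Sum>i=1..j+1. helmert j i * f i) = (\<Sum>i=1..j+1. f i)"
    by (rule sum.cong) (auto simp: helmert_def)
  finally show ?thesis .
qed

lemma sum_helmert: "j + 2 \<le> n \<Longrightarrow> (\<Sum>i=1..n. helmert j i) = 0"
  using sum_helmert_mult[of j n "\<lambda>_. 1"] by simp

text \<open>For \<open>j < l\<close> the contrast \<open>helmert l\<close> is constant where
  \<open>helmert j\<close> is nonzero on \<open>{1..n}\<close>, and \<open>helmert j\<close> sums to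
  zero there.\<close>

lemma sum_helmert_orthogonal:
  assumes "j + 2 \<le> n" "l + 2 \<le> n" "j \<noteq> l"
  shows "(\<Sum>i=1..n. helmert j i * helmert l i) = 0"
proof -
  have *: "(\<Sum>i=1..n. helmert j i * helmert l i) = 0" if "j + 2 \<le> n" "j < l" for j l
  proof -
    have "(\<Sum>i=1..j+1. helmert l i) = (\<Sum>i=1..j+1. 1)"
      using that by (intro sum.cong) (auto simp: helmert_def)
    then show ?thesis
      unfolding sum_helmert_mult[OF that(1), of "helmert l"] using that(2) by (simp add: helmert_def)
  qed
  show ?thesis
    using *[of j l] *[of l j] assms by (cases "j < l") (auto simp: mult.commute)
qed

lemma sum_helmert_square:
  assumes "j + 2 \<le> n"
  shows "(\<Sum>i=1..n. helmert j i * helmert j i) > 0"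
proof -
  have "0 < helmert j 1 * helmert j 1" by (simp add: helmert_def)
  also have "\<dots> \<le> (\<Sum>i=1..n. helmert j i * helmert j i)"
    using assms by (intro member_le_sum) auto
  finally show ?thesis .
qed

section \<open>Reflections of an EITFF and the bound on the number of subspaces\<close>

lemma reflection_anticommutator:
  fixes P Q :: "complex^'d^'d"
  shows "(2 *\<^sub>R P - mat 1) ** (2 *\<^sub>R Q - mat 1) + (2 *\<^sub>R Q - mat 1) ** (2 *\<^sub>R P - mat 1)
    = 2 *\<^sub>R (mat 1 - 2 *\<^sub>R (P + Q - P ** Q - Q ** P))"
  unfolding scaleR_2
  by (simp only: matrix_mul_diff matrix_add_ldistrib matrix_add_rdistrib' matrix_mul_lid
      matrix_mul_rid) (simp only: algebra_simps)

text \<open>Half dimension makes \<open>isoclinic_projections\<close> applicable to any two distinct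
  projections. Tightness prevents all of them from coinciding, and the resulting
  \<open>\<sigma>\<^sup>2 < 1\<close> then excludes every coincidence.\<close>

lemma EITFF_reflections:
  fixes U :: "nat \<Rightarrow> (complex^'d) set"
  assumes "EITFF r n U" "CARD('d) = 2 * r" "r \<ge> 1"
  obtains b where "b > 0" and "\<And>i j. i \<in> {1..n} \<Longrightarrow> j \<in> {1..n} \<Longrightarrow>
    (2 *\<^sub>R orth_proj (U i) - mat 1) ** (2 *\<^sub>R orth_proj (U j) - mat 1)
      + (2 *\<^sub>R orth_proj (U j) - mat 1) ** (2 *\<^sub>R orth_proj (U i) - mat 1)
    = ((2 - b) + (if i = j then b else 0)) *\<^sub>R mat 1"
proof -
  define P where "P i = orth_proj (U i)" for i
  obtain \<sigma> a where n: "n \<ge> 2" and U: "\<And>i. i \<in> {1..n} \<Longrightarrow> vec.subspace (U i)"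
      "\<And>i. i \<in> {1..n} \<Longrightarrow> vec.dim (U i) = r"
    and iso: "\<And>i j. i \<in> {1..n} \<Longrightarrow> j \<in> {1..n} \<Longrightarrow> i \<noteq> j \<Longrightarrow> P i ** P j ** P i = \<sigma>\<^sup>2 *\<^sub>R P i"
    and a: "a > 0" "(\<Sum>i=1..n. P i) = a *\<^sub>R mat 1"
    using assms(1) unfolding EITFF_def equi_isoclinic_def tight_fusion_frame_def P_def by metis
  have idem: "P i ** P i = P i" if "i \<in> {1..n}" for i
    using U(1)[OF that] by (simp add: P_def orth_proj_idem)
  \<comment> \<open>Chosen so that \<open>2 - b\<close> is
    \<open>2 * (1 - 2 * (1 - \<sigma>\<^sup>2))\<close>, the scalar arising from
    \<open>reflection_anticommutator\<close>.\<close>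
  define b where "b = 4 * (1 - \<sigma>\<^sup>2)"
  \<comment> \<open>If all projections agreed, each would be a positive multiple of the identity,
    and \<open>U 1\<close> would be the whole space although \<open>r < 2 * r\<close>.\<close>
  have distinct: "\<exists>i\<in>{1..n}. P i \<noteq> P 1"
  proof (rule ccontr)
    assume "\<not> (\<exists>i\<in>{1..n}. P i \<noteq> P 1)"
    then have "(\<Sum>i=1..n. P i) = (\<Sum>i=1..n. P 1)"
      by (intro sum.cong refl) blast
    then have eq: "real n *\<^sub>R P 1 = a *\<^sub>R mat 1" unfolding a(2) sum_constant_scaleR by simp
    have "x \<in> U 1" for x
    proof -
      have "x = (1 / a) *\<^sub>R ((a *\<^sub>R mat 1) *v x)"
        using a(1) by (simp add: scaleR_matrix_vector_mult vec_eq_iff complex_eq_iff)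
      also have "\<dots> = complex_of_real (real n / a) *s (P 1 *v x)"
        unfolding eq[symmetric] scaleR_matrix_vector_mult by (simp add: vec_eq_iff complex_eq_iff)
      also have "\<dots> \<in> U 1"
        using n U(1)[of 1] by (simp add: P_def vec.subspace_scale orth_proj_works(1) del: of_real_divide)
      finally show ?thesis .
    qed
    then have "U 1 = UNIV" by blast
    then have "vec.dim (UNIV :: (complex^'d) set) = r" using U(2)[of 1] n by simp
    then show False unfolding vec_dim_card using assms(2,3) by simp
  qed
  have iso2: "\<sigma>\<^sup>2 < 1 \<and> P i + P j - P i ** P j - P j ** P i = (1 - \<sigma>\<^sup>2) *\<^sub>R mat 1"
    if "i \<in> {1..n}" "j \<in> {1..n}" "P i \<noteq> P j" for i j
    using that isoclinic_projections[of "U i" "U j" "P i" "P j" "\<sigma>\<^sup>2"] U assms(2)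
      iso[of i j] iso[of j i] by (metis P_def mult_2)
  obtain i0 where i0: "i0 \<in> {1..n}" "P i0 \<noteq> P 1" using distinct by blast
  have s: "\<sigma>\<^sup>2 < 1" using iso2[of i0 1] i0 n by simp
  have "P i \<noteq> P j" if ij: "i \<in> {1..n}" "j \<in> {1..n}" "i \<noteq> j" for i j
  proof
    assume eq: "P i = P j"
    then have "P i = \<sigma>\<^sup>2 *\<^sub>R P i" using iso[OF ij] idem[OF ij(2)] by simp
    then have "(1 - \<sigma>\<^sup>2) *\<^sub>R P i = 0" by (simp add: scaleR_diff_left)
    then have P0: "P i = 0" using s by simp
    have "U i \<subseteq> {0}"
    proof
      fix x assume "x \<in> U i"
      then have "P i *v x = x" using U(1)[OF ij(1)] by (simp add: P_def orth_proj_fixes)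
      then show "x \<in> {0}" by (simp add: P0)
    qed
    then have "vec.dim (U i) \<le> vec.dim {0 :: complex^'d}" by (rule vec.dim_subset)
    then show False using U(2)[OF ij(1)] assms(3) by simp
  qed
  then have rel: "P i + P j - P i ** P j - P j ** P i = (1 - \<sigma>\<^sup>2) *\<^sub>R mat 1"
    if "i \<in> {1..n}" "j \<in> {1..n}" "i \<noteq> j" for i j
    using iso2 that by blast
  show thesis
  proof (rule that)
    show "b > 0" using s by (simp add: b_def)
    fix i j assume ij: "i \<in> {1..n}" "j \<in> {1..n}"
    show "(2 *\<^sub>R orth_proj (U i) - mat 1) ** (2 *\<^sub>R orth_proj (U j) - mat 1)
        + (2 *\<^sub>R orth_proj (U j) - mat 1) ** (2 *\<^sub>R orth_proj (U i) - mat 1)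
      = ((2 - b) + (if i = j then b else 0)) *\<^sub>R mat 1"
      unfolding P_def[symmetric] reflection_anticommutator
    proof (cases "i = j")
      case True
      then show "2 *\<^sub>R (mat 1 - 2 *\<^sub>R (P i + P j - P i ** P j - P j ** P i))
          = ((2 - b) + (if i = j then b else 0)) *\<^sub>R mat 1"
        using idem[OF ij(1)] by simp
    next
      case False
      then show "2 *\<^sub>R (mat 1 - 2 *\<^sub>R (P i + P j - P i ** P j - P j ** P i))
          = ((2 - b) + (if i = j then b else 0)) *\<^sub>R mat 1"
        unfolding rel[OF ij False]
        by (simp add: b_def scaleR_left_diff_distrib scaleR_right_diff_distrib)
    qed
  qed
qed

text \<open>The Helmert contrasts of the \<open>n\<close> reflections give \<open>n - 1\<close>
  anticommuting involutions. The unitary realizing a transposition is the \<open>Y\<close> of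
  \<open>anticommuting_dvd_dim\<close>, which matters for even \<open>n\<close>.\<close>

lemma totally_symmetric_EITFF_bound:
  fixes U :: "nat \<Rightarrow> (complex^'d) set"
  assumes "EITFF r n U" "total_symmetry n U" "CARD('d) = 2 * r" "r = N * 2 ^ k" "odd N"
  shows "n \<le> 2 * k + 3"
proof -
  have r: "r \<ge> 1" using assms(4) odd_pos[OF assms(5)] by (simp add: Suc_le_eq)
  have n: "n \<ge> 2" using assms(1) by (simp add: EITFF_def)
  define R where "R i = 2 *\<^sub>R orth_proj (U i) - mat 1" for i
  obtain b where b: "b > 0" and R: "\<And>i j. i \<in> {1..n} \<Longrightarrow> j \<in> {1..n} \<Longrightarrow>
      R i ** R j + R j ** R i = ((2 - b) + (if i = j then b else 0)) *\<^sub>R mat 1"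
    using EITFF_reflections[OF assms(1,3) r] unfolding R_def by metis
  define L where "L u = (\<Sum>i=1..n. u i *\<^sub>R R i)" for u
  have LL: "L u ** L v + L v ** L u = ((2 - b) * sum u {1..n} * sum v {1..n} + b * (\<Sum>i=1..n. u i * v i)) *\<^sub>R mat 1"
    for u v
    unfolding L_def by (rule anticommutator_combination) (use R in auto)
  define q where "q j = (\<Sum>i=1..n. helmert j i * helmert j i)" for j
  define E where "E j = sqrt (2 / (b * q j)) *\<^sub>R L (helmert j)" for j
  have dbl: "M = c *\<^sub>R mat 1" if "M + M = (2 * c) *\<^sub>R mat 1" for M :: "complex^'d^'d" and c
  proof -
    have "2 *\<^sub>R M = 2 *\<^sub>R (c *\<^sub>R mat 1)" using that by (simp only: scaleR_2 scaleR_scaleR)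
    then show ?thesis by (subst (asm) scaleR_cancel_left) simp
  qed
  have E_sq: "E j ** E j = mat 1" if "j < n - 1" for j
  proof -
    have j: "j + 2 \<le> n" using that by simp
    then have q: "q j > 0" unfolding q_def by (rule sum_helmert_square)
    have "L (helmert j) ** L (helmert j) = (b * q j / 2) *\<^sub>R mat 1"
      by (rule dbl) (use LL[of "helmert j" "helmert j"] sum_helmert[OF j] in \<open>simp add: q_def\<close>)
    moreover have "sqrt (2 / (b * q j)) * sqrt (2 / (b * q j)) = 2 / (b * q j)"
      using b q by simp
    ultimately have "E j ** E j = (2 / (b * q j) * (b * q j / 2)) *\<^sub>R mat 1"
      unfolding E_def matrix_mul_scaleR scaleR_scaleR by simp
    then show ?thesis using b q by simp
  qed
  have E_anti: "E i ** E j = - (E j ** E i)" if "i < n - 1" "j < n - 1" "i \<noteq> j" for i j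
  proof -
    have "i + 2 \<le> n" "j + 2 \<le> n" using that by auto
    then have "L (helmert i) ** L (helmert j) + L (helmert j) ** L (helmert i) = 0"
      using LL[of "helmert i" "helmert j"] sum_helmert sum_helmert_orthogonal that(3) by simp
    then have "L (helmert i) ** L (helmert j) = - (L (helmert j) ** L (helmert i))"
      by (simp add: eq_neg_iff_add_eq_0)
    then show ?thesis by (simp add: E_def matrix_mul_scaleR)
  qed
  \<comment> \<open>\<open>helmert 0\<close> is the difference of the first two vertices, and every
    later contrast agrees on them. Hence this transposition negates \<open>E 0\<close> and fixes the
    other \<open>E j\<close>.\<close>
  define p where "p = Transposition.transpose (1::nat) 2"
  have p: "p permutes {1..n}" unfolding p_def using n by (intro permutes_swap_id) auto
  then obtain Y where Y: "unitary_matrix Y"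
    "\<And>i. i \<in> {1..n} \<Longrightarrow> orth_proj (U (p i)) = Y ** orth_proj (U i) ** cadjoint Y"
    using assms(2) unfolding total_symmetry_def is_symmetry_def by metis
  have YR: "Y ** R i = R (p i) ** Y" if "i \<in> {1..n}" for i
    using Y(1) by (simp add: R_def Y(2)[OF that] matrix_distribs unitary_matrix_def
        flip: matrix_mul_assoc)
  have YL: "Y ** L u = L (u \<circ> p) ** Y" for u
  proof -
    have "L (u \<circ> p) = (\<Sum>i=1..n. (u \<circ> p) (p i) *\<^sub>R R (p i))"
      unfolding L_def by (subst sum.permute[OF p]) (simp add: comp_def)
    then have "L (u \<circ> p) = (\<Sum>i=1..n. u i *\<^sub>R R (p i))" by (simp add: p_def)
    then show ?thesis
      unfolding L_def by (simp add: matrix_mul_sum matrix_mul_sum_right matrix_mul_scaleR YR)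
  qed
  have p0: "L (helmert 0 \<circ> p) = - L (helmert 0)"
    unfolding L_def sum_negf[symmetric]
    by (rule sum.cong) (auto simp: helmert_def p_def Transposition.transpose_def)
  have pj: "helmert j \<circ> p = helmert j" if "j > 0" for j
    using that by (auto simp: helmert_def p_def Transposition.transpose_def)
  have "2 ^ ((n - 1 + 1) div 2) dvd vec.dim (UNIV :: (complex^'d) set)"
  proof (rule anticommuting_dvd_dim[where E = E and Y = Y])
    show "inj ((*v) Y)"
      by (rule inj_on_inverseI[where g = "(*v) (cadjoint Y)"])
        (use Y(1) in \<open>simp add: matrix_vector_mul_assoc unitary_matrix_def\<close>)
    show "Y ** E 0 = - (E 0 ** Y)"
      by (simp add: E_def matrix_distribs YL p0)
    show "Y ** E i = E i ** Y" if "0 < i" for i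
      using that by (simp add: E_def matrix_distribs YL pj)
    show "E i ** E j = - (E j ** E i)" if "i < n - 1" "j < n - 1" "i \<noteq> j" for i j
      using that by (rule E_anti)
  qed (simp_all add: E_sq)
  \<comment> \<open>The exponent \<open>k + 1\<close> accounts for the dimension
    \<open>2 * r\<close> rather than \<open>r\<close>.\<close>
  then have "2 ^ (n div 2) dvd N * 2 ^ (k + 1)"
    unfolding vec_dim_card using n assms(3,4) by (simp add: mult_ac)
  moreover have "coprime (2 ^ (n div 2)) N" using assms(5) by simp
  ultimately have "(2::nat) ^ (n div 2) dvd 2 ^ (k + 1)"
    by (simp only: coprime_dvd_mult_right_iff)
  then have "n div 2 \<le> k + 1" by (rule power_dvd_imp_le) simp
  then show ?thesis by simp
qed

section \<open>Construction of totally symmetric frames\<close>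

text \<open>The reflections are the normalized vertices \<open>E i - mean\<close> of the simplex spanned by the
  generators.  The sum \<open>F\<close> of the generators anticommutes with all of them, and a transposition of
  two vertices is implemented by the product of the unit vector \<open>D\<close> along their difference with the
  normalized \<open>F\<close>, which cancels the overall sign of conjugation by \<open>D\<close>.\<close>

lemma totally_symmetric_EITFF_exists:
  fixes n r :: nat
  assumes n: "n \<ge> 2" "n \<le> 2 * k + 3" and d: "CARD('d::finite) = 2 * r" "2 ^ (k + 1) dvd 2 * r"
  shows "\<exists>U :: nat \<Rightarrow> (complex^'d) set. EITFF r n U \<and> total_symmetry n U"
proof -
  obtain G :: "nat \<Rightarrow> complex^'d^'d" where G:
    "\<And>p. p \<le> 2 * (k + 1) \<Longrightarrow> cadjoint (G p) = G p"
    "\<And>p. p \<le> 2 * (k + 1) \<Longrightarrow> G p ** G p = mat 1"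
    "\<And>p q. p \<le> 2 * (k + 1) \<Longrightarrow> q \<le> 2 * (k + 1) \<Longrightarrow> p \<noteq> q \<Longrightarrow> G p ** G q = - (G q ** G p)"
    using anticommuting_hermitian_exist[of "k + 1", where ?'n = 'd] d by metis
  \<comment> \<open>The indices from 0 to \<open>2 * (k + 1)\<close> supply \<open>2 * k + 3\<close>
    matrices, the largest \<open>n\<close> allowed.\<close>
  define E where "E i = G (i - 1)" for i
  have E_herm: "cadjoint (E i) = E i" and E_sq: "E i ** E i = mat 1" if "i \<in> {1..n}" for i
    using that n(2) G(1,2)[of "i - 1"] by (auto simp: E_def)
  have E_anti: "E i ** E j = - (E j ** E i)" if "i \<in> {1..n}" "j \<in> {1..n}" "i \<noteq> j" for i j
    unfolding E_def by (rule G(3)) (use that n(2) in auto)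
  define L where "L u = (\<Sum>i=1..n. u i *\<^sub>R E i)" for u
  have LL: "L u ** L v + L v ** L u = (2 * (\<Sum>i=1..n. u i * v i)) *\<^sub>R mat 1" for u v
  proof -
    have "E i ** E j + E j ** E i = (0 + (if i = j then 2 else 0)) *\<^sub>R mat 1"
      if "i \<in> {1..n}" "j \<in> {1..n}" for i j
    proof (cases "i = j")
      case True
      then show ?thesis unfolding scaleR_2 using E_sq[OF that(1)] by (simp add: scaleR_2)
    next
      case False
      then show ?thesis using E_anti[OF that False] by simp
    qed
    from anticommutator_combination[of "{1..n}" E 0 2 u v, OF _ this] show ?thesis
      by (simp add: L_def)
  qed
  have L_sq: "L u ** L u = (\<Sum>i=1..n. u i * u i) *\<^sub>R mat 1" for u
  proof -
    have "2 *\<^sub>R (L u ** L u) = 2 *\<^sub>R ((\<Sum>i=1..n. u i * u i) *\<^sub>R mat 1)"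
      using LL[of u u] by (simp only: scaleR_2 scaleR_scaleR)
    then show ?thesis by (subst (asm) scaleR_cancel_left) simp
  qed
  have L_anti: "L u ** L v = - (L v ** L u)" if "(\<Sum>i=1..n. u i * v i) = 0" for u v
    using LL[of u v] that by (simp add: eq_neg_iff_add_eq_0)
  have L_herm: "cadjoint (L u) = L u" for u
    using E_herm by (simp add: L_def cadjoint_sum)
  have L_scale: "L (\<lambda>i. c * u i) = c *\<^sub>R L u" for c u
    by (simp add: L_def scaleR_sum_right)
  \<comment> \<open>A unit basis vector minus the mean of all \<open>n\<close> has squared length
    \<open>(n - 1) / n\<close>, which \<open>c\<close> normalizes.\<close>
  define c where "c = sqrt (n / (n - 1))"
  have c: "c * c = n / (n - 1)" using n by (simp add: c_def)
  define w where "w i l = c * ((if i = l then 1 else 0) - 1 / n)" for i l :: nat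
  define R where "R i = L (w i)" for i
  define F where "F = L (\<lambda>_. 1)"
  have delta: "(\<Sum>l=1..n. (if i = l then x l else 0)) = (x i :: real)" if "i \<in> {1..n}" for i x
    using that by simp
  have w_sum: "(\<Sum>l=1..n. w i l) = 0" if "i \<in> {1..n}" for i
    using n that by (simp add: w_def sum_subtractf flip: sum_distrib_left)
  have ww: "(\<Sum>l=1..n. w i l * w j l) = (if i = j then 1 else - 1 / (n - 1))"
    if ij: "i \<in> {1..n}" "j \<in> {1..n}" for i j
  proof -
    have "(\<Sum>l=1..n. w i l * w j l)
        = (\<Sum>l=1..n. c * (if j = l then w i l else 0) - c / n * w i l)"
      by (rule sum.cong) (auto simp: w_def algebra_simps)
    also have "\<dots> = c * w i j"
      unfolding sum_subtractf sum_distrib_left[symmetric] w_sum[OF ij(1)] delta[OF ij(2)] by simp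
    also have "\<dots> = n / (n - 1) * ((if i = j then 1 else 0) - 1 / n)"
      unfolding w_def mult.assoc[symmetric] c by simp
    also have "\<dots> = (if i = j then 1 else - 1 / (n - 1))"
      using n by (cases "i = j") (simp_all add: field_simps of_nat_diff)
    finally show ?thesis .
  qed
  have R_herm: "cadjoint (R i) = R i" for i by (simp add: R_def L_herm)
  have R_sq: "R i ** R i = mat 1" if "i \<in> {1..n}" for i
    using L_sq[of "w i"] ww[OF that that] by (simp add: R_def)
  \<comment> \<open>The cosine of the angle between two vertices of the regular simplex;
    \<open>(1 + g) / 2\<close> becomes the isoclinic constant
    \<open>\<sigma>\<^sup>2\<close>.\<close>
  define g where "g = - 1 / (real n - 1)"
  have R_rel: "R i ** R j + R j ** R i = (2 * g) *\<^sub>R mat 1"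
    if "i \<in> {1..n}" "j \<in> {1..n}" "i \<noteq> j" for i j
    using LL[of "w i" "w j"] ww[OF that(1,2)] that(3) n by (simp add: R_def g_def of_nat_diff)
  have F_herm: "cadjoint F = F" by (simp add: F_def L_herm)
  have F_sq: "F ** F = n *\<^sub>R mat 1" using L_sq[of "\<lambda>_. 1"] by (simp add: F_def)
  have FR: "F ** R i = - (R i ** F)" if "i \<in> {1..n}" for i
    unfolding F_def R_def by (rule L_anti) (use w_sum[OF that] in simp)
  have R_sum: "(\<Sum>i=1..n. R i) = 0"
  proof -
    have "(\<Sum>i=1..n. R i) = (\<Sum>l=1..n. (\<Sum>i=1..n. w i l) *\<^sub>R E l)"
      unfolding R_def L_def by (subst sum.swap) (simp only: scaleR_sum_left)
    also have "\<dots> = (\<Sum>l=1..n. (\<Sum>i=1..n. w l i) *\<^sub>R E l)"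
      by (intro sum.cong arg_cong2[where f = scaleR] refl) (auto simp: w_def)
    finally show ?thesis using w_sum by simp
  qed
  define P where "P i = (1/2) *\<^sub>R (mat 1 + R i)" for i
  have P_herm: "cadjoint (P i) = P i" for i by (simp add: P_def R_herm)
  have P_sq: "P i ** P i = P i" if "i \<in> {1..n}" for i
  proof -
    have "P i ** P i = (1/4) *\<^sub>R (2 *\<^sub>R (mat 1 + R i))"
      unfolding scaleR_2 by (simp add: P_def matrix_distribs R_sq[OF that] add_ac)
    then show ?thesis by (simp add: P_def)
  qed
  have PQP: "P i ** P j ** P i = ((1 + g) / 2) *\<^sub>R P i"
    if ij: "i \<in> {1..n}" "j \<in> {1..n}" "i \<noteq> j" for i j
  proof -
    have "R i ** R j ** R i = ((2 * g) *\<^sub>R mat 1 - R j ** R i) ** R i"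
      using R_rel[OF ij] by (metis add_diff_cancel_right')
    also have "\<dots> = (2 * g) *\<^sub>R R i - R j"
      by (simp add: matrix_distribs R_sq[OF ij(1)] flip: matrix_mul_assoc)
    finally have RSR: "R i ** R j ** R i = (2 * g) *\<^sub>R R i - R j" .
    have "(mat 1 + R i) ** (mat 1 + R j) ** (mat 1 + R i)
        = mat 1 + R i + R i + mat 1 + R j + (R i ** R j + R j ** R i) + R i ** R j ** R i"
      by (simp add: matrix_distribs R_sq[OF ij(1)] add_ac)
    also have "\<dots> = (2 * (1 + g)) *\<^sub>R (mat 1 + R i)"
      unfolding RSR R_rel[OF ij] distrib_left mult_1_right
      by (simp only: scaleR_add_left scaleR_add_right scaleR_2) (simp add: add_ac)
    finally show ?thesis by (simp add: P_def matrix_mul_scaleR)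
  qed
  define U where "U i = range ((*v) (P i))" for i
  have U: "vec.subspace (U i)" "orth_proj (U i) = P i" if "i \<in> {1..n}" for i
    unfolding U_def using orth_proj_range[OF P_sq[OF that] P_herm] by auto
  have U_dim: "vec.dim (U i) = r" if i: "i \<in> {1..n}" for i
  proof -
    \<comment> \<open>\<open>F\<close> is invertible and anticommutes with \<open>R i\<close>, so
      the eigenspace of \<open>R i\<close> for 1 has exactly half the dimension.\<close>
    have "inj ((*v) F)"
      by (rule inj_on_inverseI[where g = "(*v) ((1 / n) *\<^sub>R F)"])
        (use n in \<open>simp add: matrix_vector_mul_assoc matrix_mul_scaleR F_sq\<close>)
    then have "vec.dim (UNIV :: (complex^'d) set) = 2 * vec.dim {x \<in> UNIV. R i *v x = x}"
      using FR[OF i] by (intro dim_eigenspace_half[OF vec.subspace_UNIV R_sq[OF i]]) auto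
    moreover have "{x \<in> UNIV. R i *v x = x} = U i"
    proof (intro subset_antisym subsetI)
      fix x assume "x \<in> {x \<in> UNIV. R i *v x = x}"
      then have "P i *v x = x"
        by (simp add: P_def scaleR_matrix_vector_mult matrix_vector_mult_add_rdistrib vec_eq_iff)
      then show "x \<in> U i" unfolding U_def by (metis rangeI)
    next
      fix x assume "x \<in> U i"
      then obtain y where y: "x = P i *v y" unfolding U_def by blast
      have "R i ** P i = P i"
        by (simp add: P_def matrix_distribs R_sq[OF i] add.commute)
      then show "x \<in> {x \<in> UNIV. R i *v x = x}" by (simp add: y matrix_vector_mul_assoc)
    qed
    ultimately show ?thesis unfolding vec_dim_card using d(1) by simp
  qed
  have iso: "equi_isoclinic n U"
    unfolding equi_isoclinic_def
  proof (intro exI[of _ "sqrt ((1 + g) / 2)"] conjI ballI impI)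
    have "1 + g \<ge> 0" using n by (simp add: g_def field_simps)
    then show "sqrt ((1 + g) / 2) \<ge> 0" by simp
    show "orth_proj (U i) ** orth_proj (U j) ** orth_proj (U i) = (sqrt ((1 + g) / 2))\<^sup>2 *\<^sub>R orth_proj (U i)"
      if "i \<in> {1..n}" "j \<in> {1..n}" "i \<noteq> j" for i j
      using that \<open>1 + g \<ge> 0\<close> PQP by (simp add: U(2))
  qed
  have tight: "tight_fusion_frame n U"
    unfolding tight_fusion_frame_def
  proof (intro exI[of _ "n / 2"] conjI)
    have "(\<Sum>i=1..n. orth_proj (U i)) = (\<Sum>i=1..n. P i)" by (simp add: U(2))
    also have "\<dots> = (1/2) *\<^sub>R ((\<Sum>i=1..n. mat 1) + (\<Sum>i=1..n. R i))"
      by (simp only: P_def scaleR_sum_right[symmetric] sum.distrib)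
    also have "\<dots> = (n / 2) *\<^sub>R mat 1"
      unfolding R_sum sum_constant_scaleR by simp
    finally show "(\<Sum>i=1..n. orth_proj (U i)) = (n / 2) *\<^sub>R mat 1" .
  qed (use n in simp)
  have transposition: "\<exists>Y. unitary_matrix Y \<and>
      (\<forall>i\<in>{1..n}. P (Transposition.transpose a b i) = Y ** P i ** cadjoint Y)"
    if ab: "a \<in> {1..n}" "b \<in> {1..n}" "a \<noteq> b" for a b
  proof -
    let ?t = "Transposition.transpose a b"
    define u where "u i = (if i = a then 1 / sqrt 2 else 0) - (if i = b then 1 / sqrt 2 else 0)" for i
    define D where "D = L u"
    have u_mult: "(\<Sum>i=1..n. u i * v i) = (v a - v b) / sqrt 2" for v
    proof -
      have "(\<Sum>i=1..n. u i * v i)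
          = (\<Sum>i=1..n. (if a = i then v i / sqrt 2 else 0) - (if b = i then v i / sqrt 2 else 0))"
        by (rule sum.cong) (auto simp: u_def)
      then show ?thesis
        unfolding sum_subtractf delta[OF ab(1)] delta[OF ab(2)] by (simp add: diff_divide_distrib)
    qed
    have D_sq: "D ** D = mat 1"
      unfolding D_def L_sq u_mult using ab(3) by (simp add: u_def)
    have D_herm: "cadjoint D = D" by (simp add: D_def L_herm)
    have DF: "D ** F = - (F ** D)"
      unfolding D_def F_def by (rule L_anti) (simp add: u_mult[of "\<lambda>_. 1", simplified])
    \<comment> \<open>Conjugation by the involution \<open>D\<close> is minus the reflection along
      \<open>u\<close>, and that reflection exchanges the vertices \<open>a\<close> and
      \<open>b\<close>.\<close>
    have DR: "D ** R i ** D = - R (?t i)" if i: "i \<in> {1..n}" for i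
    proof -
      have "R i - R (?t i) = (c * sqrt 2 * ((if i = a then 1 else 0) - (if i = b then 1 else 0))) *\<^sub>R D"
      proof -
        have "R i - R (?t i) = L (\<lambda>l. w i l - w (?t i) l)"
          by (simp add: R_def L_def sum_subtractf scaleR_diff_left)
        also have "(\<lambda>l. w i l - w (?t i) l)
            = (\<lambda>l. (c * sqrt 2 * ((if i = a then 1 else 0) - (if i = b then 1 else 0))) * u l)"
          using ab(3) by (auto simp: w_def u_def Transposition.transpose_def algebra_simps)
        finally show ?thesis unfolding L_scale D_def .
      qed
      moreover have "D ** R i + R i ** D
          = (c * sqrt 2 * ((if i = a then 1 else 0) - (if i = b then 1 else 0))) *\<^sub>R mat 1"
        unfolding D_def R_def LL u_mult
        using ab(3) by (auto simp: w_def field_simps intro!: arg_cong[where f = "\<lambda>x. x *\<^sub>R mat 1"])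
      ultimately have "R i - R (?t i) = (D ** R i + R i ** D) ** D"
        by (simp add: matrix_mul_scaleR)
      also have "\<dots> = D ** R i ** D + R i"
        by (simp add: matrix_add_rdistrib' D_sq flip: matrix_mul_assoc)
      finally show ?thesis by (simp add: eq_neg_iff_add_eq_0 algebra_simps)
    qed
    define Y where "Y = (1 / sqrt n) *\<^sub>R (D ** F)"
    have Ya: "cadjoint Y = (1 / sqrt n) *\<^sub>R (F ** D)"
      by (simp add: Y_def cadjoint_mult D_herm F_herm)
    have conj: "Y ** X ** cadjoint Y = (1 / n) *\<^sub>R (D ** (F ** X ** F) ** D)" for X
      unfolding Ya by (simp add: Y_def matrix_mul_scaleR matrix_mul_assoc)
    have conj1: "Y ** cadjoint Y = mat 1"
      using conj[of "mat 1"] n by (simp add: F_sq matrix_mul_scaleR D_sq)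
    then have "cadjoint Y ** Y = mat 1" by (simp add: matrix_left_right_inverse)
    moreover have "P (?t i) = Y ** P i ** cadjoint Y" if i: "i \<in> {1..n}" for i
    proof -
      have "F ** R i ** F = - (n *\<^sub>R R i)"
        by (simp add: FR[OF i] matrix_distribs F_sq flip: matrix_mul_assoc)
      then have "Y ** R i ** cadjoint Y = R (?t i)"
        unfolding conj using n by (simp add: matrix_distribs DR[OF i])
      then show ?thesis
        by (simp add: P_def matrix_distribs conj1)
    qed
    ultimately show ?thesis using conj1 unfolding unitary_matrix_def by blast
  qed
  have "total_symmetry n U"
    unfolding total_symmetry_def
  proof (intro allI impI)
    fix p assume "p permutes {1..n}"
    from this finite_atLeastAtMost show "is_symmetry n U p"
    \<comment> \<open>Transpositions generate the symmetric group, and the implementing unitaries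
      multiply.\<close>
    proof (induction p rule: permutes_induct)
      case id
      show ?case unfolding is_symmetry_def
        by (intro exI[of _ "mat 1"]) (simp add: unitary_matrix_def)
    next
      case (swap a b p)
      obtain Y where Y: "unitary_matrix Y" "\<And>i. i \<in> {1..n} \<Longrightarrow> P (p i) = Y ** P i ** cadjoint Y"
        using swap.IH permutes_in_image[OF swap.hyps(4)] U(2) unfolding is_symmetry_def by metis
      obtain Z where Z: "unitary_matrix Z"
        "\<And>i. i \<in> {1..n} \<Longrightarrow> P (Transposition.transpose a b i) = Z ** P i ** cadjoint Z"
        using transposition[OF swap.hyps(1-3)] by blast
      show ?case unfolding is_symmetry_def
      proof (intro exI[of _ "Z ** Y"] conjI ballI)
        have "cadjoint Z ** Z ** X = X" "Z ** cadjoint Z = mat 1" "cadjoint Y ** Y = mat 1"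
          "Y ** cadjoint Y ** X = X" for X
          using Y(1) Z(1) by (simp_all add: unitary_matrix_def)
        then show "unitary_matrix (Z ** Y)"
          unfolding unitary_matrix_def cadjoint_mult by (metis matrix_mul_assoc)
        fix i assume i: "i \<in> {1..n}"
        then have "p i \<in> {1..n}" using permutes_in_image[OF swap.hyps(4)] by blast
        moreover from this have "Transposition.transpose a b (p i) \<in> {1..n}"
          using swap.hyps(1,2) by (auto simp: Transposition.transpose_def)
        ultimately show "orth_proj (U ((Transposition.transpose a b \<circ> p) i))
            = Z ** Y ** orth_proj (U i) ** cadjoint (Z ** Y)"
          using i by (simp add: U(2) Y(2) Z(2) cadjoint_mult matrix_mul_assoc)
      qed
    qed
  qed
  moreover have "EITFF r n U"
    unfolding EITFF_def using n(1) U(1) U_dim iso tight by blast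
  ultimately show ?thesis by blast
qed

section \<open>The equivalence and the value of the Radon--Hurwitz number\<close>

theorem theorem4p3:
  fixes r n :: nat
  assumes "r \<ge> 1" and "n \<ge> 3"
    and "CARD('r::finite) = r" and "CARD('d::finite) = 2 * r"
  shows "((\<exists>U :: nat \<Rightarrow> (complex^'d) set. EITFF r n U \<and> total_symmetry n U)
            \<longleftrightarrow> n \<le> radon_hurwitz_complex TYPE('r) + 1)
         \<and> (\<forall>a b c :: nat. c \<le> 3 \<longrightarrow> r = (2 * a + 1) * 2 ^ (4 * b + c)
              \<longrightarrow> radon_hurwitz_complex TYPE('r) = 8 * b + 2 * c + 2)"
proof (intro conjI allI impI)
  \<comment> \<open>With \<open>k\<close> the exponent of 2 in \<open>r\<close>, both sides of the
    equivalence become \<open>n \<le> 2 * k + 3\<close>.\<close>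
  obtain N where "r = 2 ^ multiplicity 2 r * N" and N: "odd N"
    by (rule multiplicity_decompose'[of r 2]) (use assms(1) in auto)
  then obtain k where r: "r = N * 2 ^ k" by (metis mult.commute)
  have \<rho>: "radon_hurwitz_complex TYPE('r) = 2 * k + 2"
    by (rule radon_hurwitz_complex_eq[OF _ N]) (simp add: assms(3) r)
  show "(\<exists>U :: nat \<Rightarrow> (complex^'d) set. EITFF r n U \<and> total_symmetry n U)
      \<longleftrightarrow> n \<le> radon_hurwitz_complex TYPE('r) + 1"
  proof
    assume "\<exists>U :: nat \<Rightarrow> (complex^'d) set. EITFF r n U \<and> total_symmetry n U"
    then have "n \<le> 2 * k + 3"
      using totally_symmetric_EITFF_bound[OF _ _ assms(4) r N] by blast
    then show "n \<le> radon_hurwitz_complex TYPE('r) + 1" by (simp add: \<rho>)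
  next
    assume "n \<le> radon_hurwitz_complex TYPE('r) + 1"
    then show "\<exists>U :: nat \<Rightarrow> (complex^'d) set. EITFF r n U \<and> total_symmetry n U"
      using assms(2,4) by (intro totally_symmetric_EITFF_exists[of n k r]) (simp_all add: \<rho> r)
  qed
next
  fix a b c :: nat
  assume "r = (2 * a + 1) * 2 ^ (4 * b + c)"
  then have "radon_hurwitz_complex TYPE('r) = 2 * (4 * b + c) + 2"
    by (intro radon_hurwitz_complex_eq[of "2 * a + 1"]) (simp_all add: assms(3))
  then show "radon_hurwitz_complex TYPE('r) = 8 * b + 2 * c + 2" by simp
qed

end
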